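(* Let $(X,d)$ be a metric space with at least two points and let $\mathcal{B}$ be a bornology on $X$ with a closed base. Then the following statements hold: (i) $\chi(C(X),\tau_{\mathcal{B}}^{sw}) = dn_{\mathcal{B}}^s(X)\cdot\chi(C(X),\tau_{\mathcal{B}}^{s})$; and $\chi(C(X),\tau_{\mathcal{B}}^{w}) = dn_{\mathcal{B}}(X)\cdot\chi(C(X),\tau_{\mathcal{B}})$. (ii) $t(C(X),\tau_{\mathcal{B}}^{sw}) = dn_{\mathcal{B}}^s(X)\cdot t(C(X),\tau_{\mathcal{B}}^{s})$; and $t(C(X),\tau_{\mathcal{B}}^{w}) = dn_{\mathcal{B}}(X)\cdot t(C(X),\tau_{\mathcal{B}})$.
   Context: A bornology on $X$ is a family $\mathcal{B}$ of nonempty subsets of $X$ that covers $X$ and is an ideal, i.e. is closed under finite unions and under passing to nonempty subsets. A base for $\mathcal{B}$ is a subfamily $\mathcal{B}_0\subseteq\mathcal{B}$ such that every $B\in\mathcal{B}$ is contained in some $B'\in\mathcal{B}_0$; $\mathcal{B}$ has a closed base if it has a base all of whose members are closed in $(X,d)$. $C(X)$ is the set of continuous functions $X\to\mathbb{R}$, and $C^+(X)$ the set of continuous functions $X\to(0,\infty)$. For $A\subseteq X$ nonempty and $\delta>0$, $A^\delta=\bigcup_{x\in A}\{y\in X: d(x,y)<\delta\}$. Four topologies on $C(X)$ are induced by the uniformities with the following bases of entourages, $B$ ranging over $\mathcal{B}$: $\tau_{\mathcal{B}}$: $\{(f,g): |f(x)-g(x)|<\epsilon\ \forall x\in B\}$,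 $\epsilon>0$ real; $\tau_{\mathcal{B}}^{s}$: $\{(f,g): \exists\,\delta>0\ \forall x\in B^\delta,\ |f(x)-g(x)|<\epsilon\}$, $\epsilon>0$ real; $\tau_{\mathcal{B}}^{w}$: $\{(f,g): |f(x)-g(x)|<\epsilon(x)\ \forall x\in B\}$, $\epsilon\in C^+(X)$; $\tau_{\mathcal{B}}^{sw}$: $\{(f,g): \exists\,\delta>0\ \forall x\in B^\delta,\ |f(x)-g(x)|<\epsilon(x)\}$, $\epsilon\in C^+(X)$. A set $F\subseteq C(X)$ is dominating (resp. strongly dominating) with respect to $\mathcal{B}$ if for every $f\in C(X)$ and $B\in\mathcal{B}$ there is $g\in F$ with $f\le g$ on $B$ (resp. there are $g\in F$ and $\delta>0$ with $f\le g$ on $B^\delta$). Then $dn_{\mathcal{B}}(X)$ (resp. $dn_{\mathcal{B}}^s(X)$) is $\aleph_0$ plus the minimum cardinality of a dominating (resp. strongly dominating) subset of $C(X)$ with respect to $\mathcal{B}$. For a topological space $Y$ and $y\in Y$: $\chi(Y,y)=\aleph_0+\min\{|\mathscr{B}_y|:\mathscr{B}_y\text{ is a local base of }Y\text{ at }y\}$ and $\chi(Y)=\sup_{y\in Y}\chi(Y,y)$ (character); $t(y,Y)=\aleph_0+\min\{\mathfrak{m}:$ for every $C\subseteq Y$ with $y\in\overline{C}$ there is $C_0\subseteq C$ with $|C_0|\le\mathfrak{m}$ and $y\in\overline{C_0}\}$ and $t(Y)=\sup_{y\in Y}t(y,Y)$ (tightness). *)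

theory Defs
  imports "HOL-Analysis.Analysis"
begin

unbundle cardinal_syntax

text \<open>Cardinals are compared across types by \<open>\<le>o\<close> and \<open>=o\<close>; \<open>natLeq\<close> is the cardinal aleph-zero.\<close>

definition min_card :: "'b set set \<Rightarrow> 'b rel" where
  "min_card S = |SOME A. A \<in> S \<and> (\<forall>A'\<in>S. |A| \<le>o |A'| )|"

lemma min_card_attained:
  assumes "S \<noteq> {}"
  shows "\<exists>A\<in>S. min_card S = |A| \<and> (\<forall>A'\<in>S. |A| \<le>o |A'| )"
proof -
  have "\<exists>r\<in>card_of ` S. \<forall>r'\<in>card_of ` S. r \<le>o r'"
    by (rule exists_minim_Well_order) (use assms card_of_Well_order in auto)
  then have "\<exists>A. A \<in> S \<and> (\<forall>A'\<in>S. |A| \<le>o |A'| )" by (simp add: Bex_def)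
  then have *: "(SOME A. A \<in> S \<and> (\<forall>A'\<in>S. |A| \<le>o |A'| )) \<in> S \<and>
      (\<forall>A'\<in>S. |SOME A. A \<in> S \<and> (\<forall>A'\<in>S. |A| \<le>o |A'| )| \<le>o |A'| )"
    by (rule someI_ex)
  show ?thesis unfolding min_card_def
    by (rule bexI[OF _ conjunct1[OF *]]) (rule conjI[OF refl conjunct2[OF *]])
qed

text \<open>Every cardinal on the type \<open>'b\<close> is at most \<open>|UNIV :: 'b set|\<close>, so it suffices to look for the
  least upper bound among the cardinalities of subsets of \<open>'b\<close>; see \<open>sup_card_upper\<close> and
  \<open>sup_card_least\<close>.\<close>

definition sup_card :: "'b rel set \<Rightarrow> 'b rel" where
  "sup_card K = min_card {A. \<forall>k\<in>K. k \<le>o |A|}"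

lemma card_order_le_UNIV:
  fixes k :: "'b rel"
  assumes "Card_order k"
  shows "k \<le>o |UNIV :: 'b set|"
  by (rule ordIso_ordLeq_trans[OF ordIso_symmetric[OF card_of_Field_ordIso[OF assms]]
        card_of_mono1[OF subset_UNIV]])

lemma sup_card_attained:
  fixes K :: "'b rel set"
  assumes "\<forall>k\<in>K. Card_order k"
  shows "\<exists>A :: 'b set. sup_card K = |A| \<and> (\<forall>k\<in>K. k \<le>o |A| ) \<and>
    (\<forall>A' :: 'b set. (\<forall>k\<in>K. k \<le>o |A'| ) \<longrightarrow> |A| \<le>o |A'| )"
proof -
  let ?S = "{A :: 'b set. \<forall>k\<in>K. k \<le>o |A|}"
  have "k \<le>o |UNIV :: 'b set|" if "k \<in> K" for k
    by (rule card_order_le_UNIV[OF bspec[OF assms that]])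
  then have "UNIV \<in> ?S" by simp
  then have "?S \<noteq> {}" by (metis empty_iff)
  from min_card_attained[OF this] obtain A
    where A: "A \<in> ?S" "min_card ?S = |A|" "\<forall>A'\<in>?S. |A| \<le>o |A'|" by (elim bexE conjE)
  show ?thesis
  proof (intro exI conjI allI impI)
    show "sup_card K = |A|" unfolding sup_card_def by (rule A(2))
    show "\<forall>k\<in>K. k \<le>o |A|" using A(1) by simp
    show "|A| \<le>o |A'|" if "\<forall>k\<in>K. k \<le>o |A'|" for A' :: "'b set"
      using A(3) that by simp
  qed
qed

lemma sup_card_upper:
  assumes "\<forall>k\<in>K. Card_order k" "k \<in> K"
  shows "k \<le>o sup_card K"
proof -
  from sup_card_attained[OF assms(1)] obtain A
    where A: "sup_card K = |A|" "\<forall>k\<in>K. k \<le>o |A|" by (elim exE conjE)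
  show ?thesis unfolding A(1) by (rule bspec[OF A(2) assms(2)])
qed

lemma sup_card_least:
  fixes K :: "'b rel set" and r :: "'c rel"
  assumes K: "\<forall>k\<in>K. Card_order k"
    and r: "Card_order r" and le: "\<And>k. k \<in> K \<Longrightarrow> k \<le>o r"
  shows "sup_card K \<le>o r"
proof -
  from sup_card_attained[OF K] obtain A :: "'b set" where A: "sup_card K = |A|"
    and least: "\<forall>A' :: 'b set. (\<forall>k\<in>K. k \<le>o |A'| ) \<longrightarrow> |A| \<le>o |A'|"
    by (elim exE conjE)
  have card_r: "|Field r| =o r" by (rule card_of_Field_ordIso[OF r])
  have "|Field r| \<le>o |UNIV :: 'b set| \<or> |UNIV :: 'b set| \<le>o |Field r|"
    by (rule ordLeq_total[OF card_of_Well_order card_of_Well_order])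
  then have "|A| \<le>o |Field r|"
  proof
    assume "|Field r| \<le>o |UNIV :: 'b set|"
    from iffD1[OF internalize_card_of_ordLeq2 this]
    obtain A' :: "'b set" where A': "|Field r| =o |A'|" by (elim exE conjE)
    have "k \<le>o |A'|" if "k \<in> K" for k
      by (rule ordLeq_ordIso_trans[OF ordLeq_ordIso_trans[OF le[OF that] ordIso_symmetric[OF card_r]] A'])
    then have "|A| \<le>o |A'|" using least by simp
    then show ?thesis by (rule ordLeq_ordIso_trans[OF _ ordIso_symmetric[OF A']])
  next
    assume *: "|UNIV :: 'b set| \<le>o |Field r|"
    show ?thesis by (rule ordLeq_transitive[OF card_of_mono1[OF subset_UNIV] *])
  qed
  then show ?thesis unfolding A by (rule ordLeq_ordIso_trans[OF _ card_r])
qed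

definition local_base :: "'b topology \<Rightarrow> 'b \<Rightarrow> 'b set set \<Rightarrow> bool" where
  "local_base Y y \<V> \<longleftrightarrow> (\<forall>V\<in>\<V>. openin Y V \<and> y \<in> V) \<and>
     (\<forall>U. openin Y U \<and> y \<in> U \<longrightarrow> (\<exists>V\<in>\<V>. V \<subseteq> U))"

definition character_at :: "'b topology \<Rightarrow> 'b \<Rightarrow> (nat + 'b set) rel" where
  "character_at Y y = natLeq +c min_card {\<V>. local_base Y y \<V>}"

definition character :: "'b topology \<Rightarrow> (nat + 'b set) rel" where
  "character Y = sup_card (character_at Y ` topspace Y)"

text \<open>The bounding cardinal is represented by a subset \<open>M\<close> of \<open>'b\<close>; \<open>M = UNIV\<close> is always admissible.\<close>

definition tightness_at :: "'b topology \<Rightarrow> 'b \<Rightarrow> (nat + 'b) rel" where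
  "tightness_at Y y = natLeq +c min_card {M :: 'b set.
     \<forall>C. C \<subseteq> topspace Y \<and> y \<in> Y closure_of C \<longrightarrow>
       (\<exists>C0\<subseteq>C. |C0| \<le>o |M| \<and> y \<in> Y closure_of C0)}"

definition tightness :: "'b topology \<Rightarrow> (nat + 'b) rel" where
  "tightness Y = sup_card (tightness_at Y ` topspace Y)"

definition bornology :: "'a set set \<Rightarrow> bool" where
  "bornology \<B> \<longleftrightarrow> {} \<notin> \<B> \<and> \<Union>\<B> = UNIV \<and>
     (\<forall>\<F>. finite \<F> \<and> \<F> \<noteq> {} \<and> \<F> \<subseteq> \<B> \<longrightarrow> \<Union>\<F> \<in> \<B>) \<and>
     (\<forall>B\<in>\<B>. \<forall>A. A \<noteq> {} \<and> A \<subseteq> B \<longrightarrow> A \<in> \<B>)"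

definition bornology_base :: "'a set set \<Rightarrow> 'a set set \<Rightarrow> bool" where
  "bornology_base \<B> \<B>0 \<longleftrightarrow> \<B>0 \<subseteq> \<B> \<and> (\<forall>B\<in>\<B>. \<exists>B'\<in>\<B>0. B \<subseteq> B')"

definition has_closed_base :: "'a::topological_space set set \<Rightarrow> bool" where
  "has_closed_base \<B> \<longleftrightarrow> (\<exists>\<B>0. bornology_base \<B> \<B>0 \<and> (\<forall>B\<in>\<B>0. closed B))"

definition enlargement :: "'a::metric_space set \<Rightarrow> real \<Rightarrow> 'a set" where
  "enlargement A \<delta> = (\<Union>x\<in>A. {y. dist x y < \<delta>})"

definition cont_funs :: "('a::metric_space \<Rightarrow> real) set" where
  "cont_funs = {f. continuous_on UNIV f}"

definition pos_cont_funs :: "('a::metric_space \<Rightarrow> real) set" where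
  "pos_cont_funs = {f \<in> cont_funs. \<forall>x. 0 < f x}"

definition uniform_topology :: "'b set \<Rightarrow> ('b \<times> 'b) set set \<Rightarrow> 'b topology" where
  "uniform_topology S \<E> =
     topology (\<lambda>U. U \<subseteq> S \<and> (\<forall>f\<in>U. \<exists>E\<in>\<E>. E `` {f} \<subseteq> U))"

definition entourages :: "'a::metric_space set set \<Rightarrow> (('a \<Rightarrow> real) \<times> ('a \<Rightarrow> real)) set set" where
  "entourages \<B> = {{(f, g). f \<in> cont_funs \<and> g \<in> cont_funs \<and>
       (\<forall>x\<in>B. \<bar>f x - g x\<bar> < \<epsilon>)} | B (\<epsilon>::real). B \<in> \<B> \<and> 0 < \<epsilon>}"

definition entourages_s :: "'a::metric_space set set \<Rightarrow> (('a \<Rightarrow> real) \<times> ('a \<Rightarrow> real)) set set" where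
  "entourages_s \<B> = {{(f, g). f \<in> cont_funs \<and> g \<in> cont_funs \<and>
       (\<exists>\<delta>>0. \<forall>x\<in>enlargement B \<delta>. \<bar>f x - g x\<bar> < \<epsilon>)} | B (\<epsilon>::real). B \<in> \<B> \<and> 0 < \<epsilon>}"

definition entourages_w :: "'a::metric_space set set \<Rightarrow> (('a \<Rightarrow> real) \<times> ('a \<Rightarrow> real)) set set" where
  "entourages_w \<B> = {{(f, g). f \<in> cont_funs \<and> g \<in> cont_funs \<and>
       (\<forall>x\<in>B. \<bar>f x - g x\<bar> < \<epsilon> x)} | B \<epsilon>. B \<in> \<B> \<and> \<epsilon> \<in> pos_cont_funs}"

definition entourages_sw :: "'a::metric_space set set \<Rightarrow> (('a \<Rightarrow> real) \<times> ('a \<Rightarrow> real)) set set" where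
  "entourages_sw \<B> = {{(f, g). f \<in> cont_funs \<and> g \<in> cont_funs \<and>
       (\<exists>\<delta>>0. \<forall>x\<in>enlargement B \<delta>. \<bar>f x - g x\<bar> < \<epsilon> x)} | B \<epsilon>. B \<in> \<B> \<and> \<epsilon> \<in> pos_cont_funs}"

definition tau :: "'a::metric_space set set \<Rightarrow> ('a \<Rightarrow> real) topology" where
  "tau \<B> = uniform_topology cont_funs (entourages \<B>)"

definition tau_s :: "'a::metric_space set set \<Rightarrow> ('a \<Rightarrow> real) topology" where
  "tau_s \<B> = uniform_topology cont_funs (entourages_s \<B>)"

definition tau_w :: "'a::metric_space set set \<Rightarrow> ('a \<Rightarrow> real) topology" where
  "tau_w \<B> = uniform_topology cont_funs (entourages_w \<B>)"

definition tau_sw :: "'a::metric_space set set \<Rightarrow> ('a \<Rightarrow> real) topology" where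
  "tau_sw \<B> = uniform_topology cont_funs (entourages_sw \<B>)"

text \<open>For a bornology the four families are nonempty and directed downwards, so that
  \<open>uniform_topology\<close> is given by its intended open sets on all of \<open>cont_funs\<close>.\<close>

lemma openin_uniform_topology:
  assumes dir: "\<And>E E'. E \<in> \<E> \<Longrightarrow> E' \<in> \<E> \<Longrightarrow> \<exists>E''\<in>\<E>. E'' \<subseteq> E \<inter> E'"
  shows "openin (uniform_topology S \<E>) U \<longleftrightarrow> U \<subseteq> S \<and> (\<forall>f\<in>U. \<exists>E\<in>\<E>. E `` {f} \<subseteq> U)"
proof -
  have "istopology (\<lambda>U. U \<subseteq> S \<and> (\<forall>f\<in>U. \<exists>E\<in>\<E>. E `` {f} \<subseteq> U))"
    unfolding istopology_def
  proof (intro conjI allI impI)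
    fix U V
    assume U: "U \<subseteq> S \<and> (\<forall>f\<in>U. \<exists>E\<in>\<E>. E `` {f} \<subseteq> U)"
      and V: "V \<subseteq> S \<and> (\<forall>f\<in>V. \<exists>E\<in>\<E>. E `` {f} \<subseteq> V)"
    show "U \<inter> V \<subseteq> S" using U by blast
    show "\<forall>f\<in>U \<inter> V. \<exists>E\<in>\<E>. E `` {f} \<subseteq> U \<inter> V"
    proof
      fix f assume "f \<in> U \<inter> V"
      then obtain E E' where "E \<in> \<E>" "E' \<in> \<E>" "E `` {f} \<subseteq> U" "E' `` {f} \<subseteq> V"
        using U V by blast
      moreover obtain E'' where "E'' \<in> \<E>" "E'' \<subseteq> E \<inter> E'"
        using dir calculation(1,2) by blast
      ultimately show "\<exists>E\<in>\<E>. E `` {f} \<subseteq> U \<inter> V" by blast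
    qed
  next
    fix \<U> :: "'a set set"
    assume *: "\<forall>U\<in>\<U>. U \<subseteq> S \<and> (\<forall>f\<in>U. \<exists>E\<in>\<E>. E `` {f} \<subseteq> U)"
    then show "\<Union>\<U> \<subseteq> S" by blast
    show "\<forall>f\<in>\<Union>\<U>. \<exists>E\<in>\<E>. E `` {f} \<subseteq> \<Union>\<U>"
      using * by (meson Union_upper UnionE subset_trans)
  qed
  then show ?thesis unfolding uniform_topology_def by (simp add: topology_inverse')
qed

lemma topspace_uniform_topology:
  assumes dir: "\<And>E E'. E \<in> \<E> \<Longrightarrow> E' \<in> \<E> \<Longrightarrow> \<exists>E''\<in>\<E>. E'' \<subseteq> E \<inter> E'"
    and "\<E> \<noteq> {}" and "\<And>E. E \<in> \<E> \<Longrightarrow> E \<subseteq> S \<times> S"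
  shows "topspace (uniform_topology S \<E>) = S"
proof
  have eq: "openin (uniform_topology S \<E>) U \<longleftrightarrow> U \<subseteq> S \<and> (\<forall>f\<in>U. \<exists>E\<in>\<E>. E `` {f} \<subseteq> U)" for U
    by (rule openin_uniform_topology) (rule dir)
  show "topspace (uniform_topology S \<E>) \<subseteq> S"
    using openin_topspace[of "uniform_topology S \<E>"] unfolding eq by blast
  have "openin (uniform_topology S \<E>) S"
    unfolding eq using assms(2,3) by blast
  then show "S \<subseteq> topspace (uniform_topology S \<E>)" by (rule openin_subset)
qed

lemma bornology_nonempty: "bornology \<B> \<Longrightarrow> \<B> \<noteq> {}"
  unfolding bornology_def by auto

lemma bornology_Un:
  assumes "bornology \<B>" "A \<in> \<B>" "B \<in> \<B>"
  shows "A \<union> B \<in> \<B>"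
proof -
  have "finite {A, B} \<and> {A, B} \<noteq> {} \<and> {A, B} \<subseteq> \<B>" using assms(2,3) by simp
  then have "\<Union>{A, B} \<in> \<B>" using assms(1) unfolding bornology_def by blast
  then show ?thesis by simp
qed

lemma pos_cont_funs_const: "0 < \<epsilon> \<Longrightarrow> (\<lambda>_. \<epsilon>) \<in> pos_cont_funs"
  unfolding pos_cont_funs_def cont_funs_def by simp

lemma pos_cont_funs_min:
  "\<epsilon> \<in> pos_cont_funs \<Longrightarrow> \<epsilon>' \<in> pos_cont_funs \<Longrightarrow> (\<lambda>x. min (\<epsilon> x) (\<epsilon>' x)) \<in> pos_cont_funs"
  unfolding pos_cont_funs_def cont_funs_def by (auto intro: continuous_on_min)

lemma entourages_nonempty:
  fixes \<B> :: "'a::metric_space set set"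
  assumes "bornology \<B>"
  shows "entourages \<B> \<noteq> {}" "entourages_s \<B> \<noteq> {}" "entourages_w \<B> \<noteq> {}" "entourages_sw \<B> \<noteq> {}"
proof -
  obtain B where B: "B \<in> \<B>" using bornology_nonempty[OF assms] by blast
  have one: "(0::real) < 1" "(\<lambda>_::'a. 1) \<in> pos_cont_funs" by (simp_all add: pos_cont_funs_const)
  show "entourages \<B> \<noteq> {}" "entourages_s \<B> \<noteq> {}" "entourages_w \<B> \<noteq> {}" "entourages_sw \<B> \<noteq> {}"
    unfolding entourages_def entourages_s_def entourages_w_def entourages_sw_def
    using B one by blast+
qed

lemma entourages_directed:
  assumes "bornology \<B>" "E \<in> entourages \<B>" "E' \<in> entourages \<B>"
  shows "\<exists>E''\<in>entourages \<B>. E'' \<subseteq> E \<inter> E'"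
proof -
  obtain B \<epsilon> where E: "E = {(f, g). f \<in> cont_funs \<and> g \<in> cont_funs \<and> (\<forall>x\<in>B. \<bar>f x - g x\<bar> < \<epsilon>)}"
    "B \<in> \<B>" "0 < \<epsilon>" using assms(2) unfolding entourages_def by blast
  obtain B' \<epsilon>' where E': "E' = {(f, g). f \<in> cont_funs \<and> g \<in> cont_funs \<and> (\<forall>x\<in>B'. \<bar>f x - g x\<bar> < \<epsilon>')}"
    "B' \<in> \<B>" "0 < \<epsilon>'" using assms(3) unfolding entourages_def by blast
  let ?E = "{(f, g). f \<in> cont_funs \<and> g \<in> cont_funs \<and> (\<forall>x\<in>B \<union> B'. \<bar>f x - g x\<bar> < min \<epsilon> \<epsilon>')}"
  have "B \<union> B' \<in> \<B>" "0 < min \<epsilon> \<epsilon>'" using bornology_Un[OF assms(1)] E E' by auto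
  then have "?E \<in> entourages \<B>" unfolding entourages_def by blast
  moreover have "?E \<subseteq> E \<inter> E'" unfolding E(1) E'(1) by auto
  ultimately show ?thesis by blast
qed

lemma entourages_w_directed:
  assumes "bornology \<B>" "E \<in> entourages_w \<B>" "E' \<in> entourages_w \<B>"
  shows "\<exists>E''\<in>entourages_w \<B>. E'' \<subseteq> E \<inter> E'"
proof -
  obtain B \<epsilon> where E: "E = {(f, g). f \<in> cont_funs \<and> g \<in> cont_funs \<and> (\<forall>x\<in>B. \<bar>f x - g x\<bar> < \<epsilon> x)}"
    "B \<in> \<B>" "\<epsilon> \<in> pos_cont_funs" using assms(2) unfolding entourages_w_def by blast
  obtain B' \<epsilon>' where E': "E' = {(f, g). f \<in> cont_funs \<and> g \<in> cont_funs \<and> (\<forall>x\<in>B'. \<bar>f x - g x\<bar> < \<epsilon>' x)}"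
    "B' \<in> \<B>" "\<epsilon>' \<in> pos_cont_funs" using assms(3) unfolding entourages_w_def by blast
  define \<eta> where "\<eta> = (\<lambda>x. min (\<epsilon> x) (\<epsilon>' x))"
  let ?E = "{(f, g). f \<in> cont_funs \<and> g \<in> cont_funs \<and> (\<forall>x\<in>B \<union> B'. \<bar>f x - g x\<bar> < \<eta> x)}"
  have "B \<union> B' \<in> \<B>" "\<eta> \<in> pos_cont_funs"
    using bornology_Un[OF assms(1)] pos_cont_funs_min E E' unfolding \<eta>_def by auto
  then have "?E \<in> entourages_w \<B>" unfolding entourages_w_def by blast
  moreover have "?E \<subseteq> E \<inter> E'" unfolding E(1) E'(1) \<eta>_def by auto
  ultimately show ?thesis by blast
qed

lemma entourages_s_directed:
  assumes "bornology \<B>" "E \<in> entourages_s \<B>" "E' \<in> entourages_s \<B>"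
  shows "\<exists>E''\<in>entourages_s \<B>. E'' \<subseteq> E \<inter> E'"
proof -
  obtain B \<epsilon> where E: "E = {(f, g). f \<in> cont_funs \<and> g \<in> cont_funs \<and>
      (\<exists>\<delta>>0. \<forall>x\<in>enlargement B \<delta>. \<bar>f x - g x\<bar> < \<epsilon>)}"
    "B \<in> \<B>" "0 < \<epsilon>" using assms(2) unfolding entourages_s_def by blast
  obtain B' \<epsilon>' where E': "E' = {(f, g). f \<in> cont_funs \<and> g \<in> cont_funs \<and>
      (\<exists>\<delta>>0. \<forall>x\<in>enlargement B' \<delta>. \<bar>f x - g x\<bar> < \<epsilon>')}"
    "B' \<in> \<B>" "0 < \<epsilon>'" using assms(3) unfolding entourages_s_def by blast
  let ?E = "{(f, g). f \<in> cont_funs \<and> g \<in> cont_funs \<and>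
      (\<exists>\<delta>>0. \<forall>x\<in>enlargement (B \<union> B') \<delta>. \<bar>f x - g x\<bar> < min \<epsilon> \<epsilon>')}"
  have "B \<union> B' \<in> \<B>" "0 < min \<epsilon> \<epsilon>'" using bornology_Un[OF assms(1)] E E' by auto
  then have "?E \<in> entourages_s \<B>" unfolding entourages_s_def by blast
  moreover have "?E \<subseteq> E \<inter> E'"
    unfolding E(1) E'(1) by (fastforce simp: enlargement_def)
  ultimately show ?thesis by blast
qed

lemma entourages_sw_directed:
  assumes "bornology \<B>" "E \<in> entourages_sw \<B>" "E' \<in> entourages_sw \<B>"
  shows "\<exists>E''\<in>entourages_sw \<B>. E'' \<subseteq> E \<inter> E'"
proof -
  obtain B \<epsilon> where E: "E = {(f, g). f \<in> cont_funs \<and> g \<in> cont_funs \<and>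
      (\<exists>\<delta>>0. \<forall>x\<in>enlargement B \<delta>. \<bar>f x - g x\<bar> < \<epsilon> x)}"
    "B \<in> \<B>" "\<epsilon> \<in> pos_cont_funs" using assms(2) unfolding entourages_sw_def by blast
  obtain B' \<epsilon>' where E': "E' = {(f, g). f \<in> cont_funs \<and> g \<in> cont_funs \<and>
      (\<exists>\<delta>>0. \<forall>x\<in>enlargement B' \<delta>. \<bar>f x - g x\<bar> < \<epsilon>' x)}"
    "B' \<in> \<B>" "\<epsilon>' \<in> pos_cont_funs" using assms(3) unfolding entourages_sw_def by blast
  define \<eta> where "\<eta> = (\<lambda>x. min (\<epsilon> x) (\<epsilon>' x))"
  let ?E = "{(f, g). f \<in> cont_funs \<and> g \<in> cont_funs \<and>
      (\<exists>\<delta>>0. \<forall>x\<in>enlargement (B \<union> B') \<delta>. \<bar>f x - g x\<bar> < \<eta> x)}"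
  have "B \<union> B' \<in> \<B>" "\<eta> \<in> pos_cont_funs"
    using bornology_Un[OF assms(1)] pos_cont_funs_min E E' unfolding \<eta>_def by auto
  then have "?E \<in> entourages_sw \<B>" unfolding entourages_sw_def by blast
  moreover have "?E \<subseteq> E \<inter> E'"
    unfolding E(1) E'(1) \<eta>_def by (fastforce simp: enlargement_def)
  ultimately show ?thesis by blast
qed

lemma openin_taus:
  assumes "bornology \<B>"
  shows "openin (tau \<B>) U \<longleftrightarrow> U \<subseteq> cont_funs \<and> (\<forall>f\<in>U. \<exists>E\<in>entourages \<B>. E `` {f} \<subseteq> U)"
    and "openin (tau_s \<B>) U \<longleftrightarrow> U \<subseteq> cont_funs \<and> (\<forall>f\<in>U. \<exists>E\<in>entourages_s \<B>. E `` {f} \<subseteq> U)"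
    and "openin (tau_w \<B>) U \<longleftrightarrow> U \<subseteq> cont_funs \<and> (\<forall>f\<in>U. \<exists>E\<in>entourages_w \<B>. E `` {f} \<subseteq> U)"
    and "openin (tau_sw \<B>) U \<longleftrightarrow> U \<subseteq> cont_funs \<and> (\<forall>f\<in>U. \<exists>E\<in>entourages_sw \<B>. E `` {f} \<subseteq> U)"
  unfolding tau_def tau_s_def tau_w_def tau_sw_def
  using openin_uniform_topology[OF entourages_directed[OF assms]]
    openin_uniform_topology[OF entourages_s_directed[OF assms]]
    openin_uniform_topology[OF entourages_w_directed[OF assms]]
    openin_uniform_topology[OF entourages_sw_directed[OF assms]]
  by simp_all

lemma topspace_taus:
  assumes "bornology \<B>"
  shows "topspace (tau \<B>) = cont_funs" "topspace (tau_s \<B>) = cont_funs"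
    "topspace (tau_w \<B>) = cont_funs" "topspace (tau_sw \<B>) = cont_funs"
proof -
  note ne = entourages_nonempty[OF assms]
  show "topspace (tau \<B>) = cont_funs"
    unfolding tau_def by (rule topspace_uniform_topology[OF entourages_directed[OF assms] ne(1)])
      (auto simp: entourages_def)
  show "topspace (tau_s \<B>) = cont_funs"
    unfolding tau_s_def by (rule topspace_uniform_topology[OF entourages_s_directed[OF assms] ne(2)])
      (auto simp: entourages_s_def)
  show "topspace (tau_w \<B>) = cont_funs"
    unfolding tau_w_def by (rule topspace_uniform_topology[OF entourages_w_directed[OF assms] ne(3)])
      (auto simp: entourages_w_def)
  show "topspace (tau_sw \<B>) = cont_funs"
    unfolding tau_sw_def by (rule topspace_uniform_topology[OF entourages_sw_directed[OF assms] ne(4)])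
      (auto simp: entourages_sw_def)
qed

definition dominating :: "'a::metric_space set set \<Rightarrow> ('a \<Rightarrow> real) set \<Rightarrow> bool" where
  "dominating \<B> F \<longleftrightarrow> F \<subseteq> cont_funs \<and>
     (\<forall>f\<in>cont_funs. \<forall>B\<in>\<B>. \<exists>g\<in>F. \<forall>x\<in>B. f x \<le> g x)"

definition strongly_dominating :: "'a::metric_space set set \<Rightarrow> ('a \<Rightarrow> real) set \<Rightarrow> bool" where
  "strongly_dominating \<B> F \<longleftrightarrow> F \<subseteq> cont_funs \<and>
     (\<forall>f\<in>cont_funs. \<forall>B\<in>\<B>. \<exists>g\<in>F. \<exists>\<delta>>0. \<forall>x\<in>enlargement B \<delta>. f x \<le> g x)"

definition dn :: "'a::metric_space set set \<Rightarrow> (nat + ('a \<Rightarrow> real)) rel" where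
  "dn \<B> = natLeq +c min_card {F. dominating \<B> F}"

definition dn_s :: "'a::metric_space set set \<Rightarrow> (nat + ('a \<Rightarrow> real)) rel" where
  "dn_s \<B> = natLeq +c min_card {F. strongly_dominating \<B> F}"

end

theory Submission
  imports Defs
begin

text \<open>
  The weak topologies and the strong ones are two instances of one situation. A property
  holding on \<open>B\<close>, respectively on some enlargement of \<open>B\<close>, is a property holding eventually along a
  filter attached to \<open>B\<close>: the principal filter of \<open>B\<close>, or the filter generated by the enlargements
  of \<open>B\<close>. The locale \<open>filtered_bornology\<close> records the few properties of these filters that matter,
  and inside it a neighbourhood of \<open>f\<close> consists of the continuous \<open>g\<close> with \<open>\<bar>f - g\<bar> < \<epsilon>\<close> eventually
  along the filter of \<open>B\<close>. In the coarse topology \<open>\<epsilon>\<close> runs through the positive constants, in the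
  fine topology through the positive continuous functions. Both formulas then say that an invariant
  of the fine topology is the domination number times the same invariant of the coarse topology.
  They are proved at each point \<open>f\<close> separately. The supremum over \<open>f\<close> preserves them because all
  cardinals involved are infinite, so that products are maxima (\<open>sup_card_cprod\<close>).

  The link with domination is that \<open>\<epsilon> \<mapsto> 1 / \<epsilon>\<close> turns arbitrarily small positive continuous functions
  into large ones. A dominating family \<open>F\<close> yields the tolerances \<open>1 / max g 1\<close> for \<open>g \<in> F\<close>, which
  are eventually below any given tolerance; conversely, a family of positive continuous functions
  that gets below every tolerance has dominating reciprocals.

  Character. A local base at \<open>f\<close> amounts to a cofinal family of pairs \<open>(A, \<eta>)\<close> with \<open>A\<close> a closed
  member of the bornology. If the neighbourhood of \<open>f\<close> given by \<open>(A, \<eta>)\<close> lies in the one given by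
  \<open>(B, \<epsilon>)\<close>, then \<open>B \<subseteq> A\<close>: otherwise a continuous function vanishing near \<open>A\<close> but not at some
  point of \<open>B\<close> separates the two (\<open>subset_if_near_subset\<close>). Therefore the sets of a cofinal family
  for one topology also serve for the other, and only the tolerances must be replaced: by the
  reciprocals of a dominating family in one direction (\<open>character_at_fine_upper\<close>), by \<open>1 / n\<close> in
  the other. Moreover \<open>f + \<eta> / 2\<close> lies in the smaller neighbourhood, so \<open>\<eta> / 2 < \<epsilon>\<close> along \<open>B\<close>, and
  the reciprocals of the functions \<open>\<eta> / 2\<close> dominate (\<open>character_at_fine_lower\<close>).

  Tightness. Each inequality deforms a set \<open>C\<close> by a map \<open>\<Theta>\<close> so that \<open>f\<close> lies in the
  closure of \<open>\<Theta> ` C\<close>, and pulls a small subset of \<open>\<Theta> ` C\<close> back to \<open>C\<close>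
  (\<open>pullback_small_subset\<close>). With \<open>\<Theta> \<eta> = f + \<eta>\<close> on the positive functions one obtains a
  dominating family. With \<open>\<Theta> g = f + max (\<bar>f - g\<bar> - 1 / n) 0\<close> closeness up to \<open>1 / n\<close> becomes
  equality, hence the coarse tightness is at most the fine one. With
  \<open>\<Theta> h = f + max g 1 * (h - f)\<close> for \<open>g\<close> in a dominating family, fine closeness becomes uniform
  closeness, which gives the upper bound for the fine tightness.
\<close>

section \<open>Cardinal bounds\<close>

lemma Cinfinite_natLeq_csum: "Cinfinite (natLeq +c r)"
  by (simp add: Cinfinite_csum natLeq_Cinfinite)

lemma natLeq_csum_ordLeq:
  assumes "Cinfinite r" "Card_order p" "p \<le>o r"
  shows "natLeq +c p \<le>o r"
  using assms
  by (intro csum_cinfinite_bound natLeq_ordLeq_cinfinite natLeq_Card_order) simp_all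

lemma natLeq_csum_min_card_ordLeq:
  assumes "Cinfinite r" "A \<in> S" "|A| \<le>o r"
  shows "natLeq +c min_card S \<le>o r"
proof -
  from assms(2) have "S \<noteq> {}" by blast
  from min_card_attained[OF this] obtain A' where A': "min_card S = |A'|" "\<forall>A''\<in>S. |A'| \<le>o |A''|"
    by (elim bexE conjE)
  have "|A'| \<le>o r" by (rule ordLeq_transitive[OF bspec[OF A'(2) assms(2)] assms(3)])
  then show ?thesis unfolding A'(1) by (intro natLeq_csum_ordLeq assms(1) card_of_Card_order)
qed

lemma natLeq_csum_min_card_witness:
  assumes "S \<noteq> {}"
  obtains A where "A \<in> S" "|A| \<le>o natLeq +c min_card S"
proof -
  from min_card_attained[OF assms] obtain A where A: "A \<in> S" "min_card S = |A|"
    by (elim bexE conjE)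
  have "|A| \<le>o natLeq +c min_card S"
    unfolding A(2) by (rule ordLeq_csum2[OF card_of_Card_order])
  with A(1) show thesis by (rule that)
qed

lemma card_of_Times_Cinfinite_bound:
  assumes "Cinfinite r" "|A| \<le>o r" "|B| \<le>o r"
  shows "|A \<times> B| \<le>o r"
  using card_of_Times_ordLeq_infinite_Field[of r A B] assms by (simp add: cinfinite_def)

lemma card_of_image_bound:
  assumes "|A| \<le>o r"
  shows "|f ` A| \<le>o r"
  using ordLeq_transitive[OF card_of_image assms] .

lemma card_of_nat_bound: "Cinfinite r \<Longrightarrow> |UNIV :: nat set| \<le>o r"
  by (rule ordIso_ordLeq_trans[OF card_of_nat natLeq_ordLeq_cinfinite])

lemma Card_order_sup_card:
  fixes K :: "'b rel set"
  assumes "\<forall>k\<in>K. Card_order k"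
  shows "Card_order (sup_card K)"
proof -
  from sup_card_attained[OF assms] obtain A :: "'b set" where "sup_card K = |A|"
    by (elim exE conjE)
  then show ?thesis by (simp add: card_of_Card_order)
qed

lemma ordLeq_cprod_left:
  assumes "Card_order p" "Cnotzero q"
  shows "p \<le>o p *c q"
  using ordLeq_ordIso_trans[OF ordLeq_cprod2[OF assms(2,1)] cprod_com] .

text \<open>Each \<open>k i\<close> is at least \<open>d\<close> and at least \<open>l i\<close>, so its supremum bounds both factors, and an
  infinite cardinal bounding both factors bounds their product.\<close>

lemma sup_card_cprod:
  fixes k :: "'i \<Rightarrow> 'b rel" and l :: "'i \<Rightarrow> 'c rel" and d :: "'d rel"
  assumes "I \<noteq> {}" and d: "Cinfinite d"
    and k: "\<And>i. i \<in> I \<Longrightarrow> Cinfinite (k i)" and l: "\<And>i. i \<in> I \<Longrightarrow> Cinfinite (l i)"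
    and eq: "\<And>i. i \<in> I \<Longrightarrow> k i =o d *c l i"
  shows "sup_card (k ` I) =o d *c sup_card (l ` I)"
proof -
  have cok: "\<forall>c\<in>k ` I. Card_order c" and col: "\<forall>c\<in>l ` I. Card_order c"
    using k l by auto
  have k_le: "k i \<le>o sup_card (k ` I)" and l_le: "l i \<le>o sup_card (l ` I)" if "i \<in> I" for i
    using that cok col by (auto intro: sup_card_upper)
  note co = Card_order_sup_card[OF cok] Card_order_sup_card[OF col]
  obtain i0 where i0: "i0 \<in> I" using assms(1) by blast
  have inf: "Cinfinite (sup_card (k ` I))" "Cinfinite (sup_card (l ` I))"
    using cinfinite_mono[OF k_le[OF i0]] cinfinite_mono[OF l_le[OF i0]] k[OF i0] l[OF i0] co
    by auto
  have le_k: "d \<le>o k i" "l i \<le>o k i" if "i \<in> I" for i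
  proof -
    have "d \<le>o d *c l i" by (rule ordLeq_cprod_left) (use d l[OF that] Cinfinite_Cnotzero in auto)
    then show "d \<le>o k i" by (rule ordLeq_ordIso_trans[OF _ ordIso_symmetric[OF eq[OF that]]])
    have "l i \<le>o d *c l i" by (rule ordLeq_cprod2) (use d l[OF that] Cinfinite_Cnotzero in auto)
    then show "l i \<le>o k i" by (rule ordLeq_ordIso_trans[OF _ ordIso_symmetric[OF eq[OF that]]])
  qed
  have "sup_card (k ` I) \<le>o d *c sup_card (l ` I)"
  proof (rule sup_card_least[OF cok Card_order_cprod])
    fix c assume "c \<in> k ` I"
    then obtain i where i: "i \<in> I" "c = k i" by blast
    have "d *c l i \<le>o d *c sup_card (l ` I)" by (rule cprod_mono2[OF l_le[OF i(1)]])
    then show "c \<le>o d *c sup_card (l ` I)" unfolding i(2) by (rule ordIso_ordLeq_trans[OF eq[OF i(1)]])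
  qed
  moreover have "sup_card (l ` I) \<le>o sup_card (k ` I)"
  proof (rule sup_card_least[OF col co(1)])
    fix c assume "c \<in> l ` I"
    then obtain i where i: "c = l i" "i \<in> I" by (rule imageE)
    show "c \<le>o sup_card (k ` I)"
      unfolding i(1) by (rule ordLeq_transitive[OF le_k(2)[OF i(2)] k_le[OF i(2)]])
  qed
  then have "d *c sup_card (l ` I) \<le>o sup_card (k ` I)"
    using d inf
    by (intro cprod_cinfinite_bound ordLeq_transitive[OF le_k(1)[OF i0] k_le[OF i0]]) simp_all
  ultimately show ?thesis by (simp add: ordIso_iff_ordLeq)
qed

section \<open>Witnesses for character and tightness\<close>

lemma Cinfinite_character_at: "Cinfinite (character_at Y y)"
  unfolding character_at_def by (rule Cinfinite_natLeq_csum)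

lemma Cinfinite_tightness_at: "Cinfinite (tightness_at Y y)"
  unfolding tightness_at_def by (rule Cinfinite_natLeq_csum)

lemma character_at_ordLeq:
  assumes "Cinfinite r" "local_base Y y \<V>" "|\<V>| \<le>o r"
  shows "character_at Y y \<le>o r"
  unfolding character_at_def by (rule natLeq_csum_min_card_ordLeq[of r \<V>]) (use assms in auto)

lemma character_at_witness:
  obtains \<V> where "local_base Y y \<V>" "|\<V>| \<le>o character_at Y y"
proof -
  have "local_base Y y {U. openin Y U \<and> y \<in> U}" unfolding local_base_def by blast
  then have "{\<V>. local_base Y y \<V>} \<noteq> {}" by blast
  from natLeq_csum_min_card_witness[OF this] obtain \<V>
    where "\<V> \<in> {\<V>. local_base Y y \<V>}" "|\<V>| \<le>o character_at Y y"
    unfolding character_at_def .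
  then show thesis by (intro that) simp_all
qed

text \<open>The bound \<open>r\<close> may live on any type, whereas \<open>tightness_at\<close> minimises over subsets of the space.
  If \<open>r\<close> is below the size of the type, it is represented by a subset; otherwise the
  whole type is an admissible bound not exceeding \<open>r\<close>.\<close>

lemma tightness_at_ordLeq:
  fixes y :: 'b
  assumes r: "Cinfinite r"
    and small: "\<And>C. C \<subseteq> topspace Y \<Longrightarrow> y \<in> Y closure_of C \<Longrightarrow>
      \<exists>C0\<subseteq>C. |C0| \<le>o r \<and> y \<in> Y closure_of C0"
  shows "tightness_at Y y \<le>o r"
proof -
  have Fr: "|Field r| =o r" by (rule card_of_Field_ordIso) (use r in simp)
  have "\<exists>M :: 'b set. |M| \<le>o r \<and> (\<forall>C0 :: 'b set. |C0| \<le>o r \<longrightarrow> |C0| \<le>o |M| )"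
  proof (rule disjE[OF ordLeq_total[OF card_of_Well_order card_of_Well_order]])
    assume "|UNIV :: 'b set| \<le>o |Field r|"
    from ordLeq_ordIso_trans[OF this Fr] show ?thesis
      by (intro exI[of _ UNIV] conjI allI impI card_of_mono1[OF subset_UNIV])
  next
    assume "|Field r| \<le>o |UNIV :: 'b set|"
    from iffD1[OF internalize_card_of_ordLeq2 this]
    obtain M :: "'b set" where "|Field r| =o |M|" by (elim exE conjE)
    then have M: "r =o |M|" by (rule ordIso_transitive[OF ordIso_symmetric[OF Fr]])
    show ?thesis
      by (intro exI[of _ M] conjI allI impI ordIso_imp_ordLeq[OF ordIso_symmetric[OF M]])
        (erule ordLeq_ordIso_trans[OF _ M])
  qed
  then obtain M :: "'b set" where M: "|M| \<le>o r" "\<forall>C0 :: 'b set. |C0| \<le>o r \<longrightarrow> |C0| \<le>o |M|"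
    by (elim exE conjE)
  let ?S = "{M :: 'b set. \<forall>C. C \<subseteq> topspace Y \<and> y \<in> Y closure_of C \<longrightarrow>
       (\<exists>C0\<subseteq>C. |C0| \<le>o |M| \<and> y \<in> Y closure_of C0)}"
  have "M \<in> ?S"
  proof (intro CollectI allI impI, elim conjE)
    fix C assume "C \<subseteq> topspace Y" "y \<in> Y closure_of C"
    from small[OF this] obtain C0 where C0: "C0 \<subseteq> C" "|C0| \<le>o r" "y \<in> Y closure_of C0"
      by (elim exE conjE)
    have "|C0| \<le>o |M|" using M(2) C0(2) by simp
    with C0(1,3) show "\<exists>C0\<subseteq>C. |C0| \<le>o |M| \<and> y \<in> Y closure_of C0" by (intro exI conjI)
  qed
  then show ?thesis unfolding tightness_at_def
    by (rule natLeq_csum_min_card_ordLeq[OF r _ M(1)])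
qed

lemma tightness_at_witness:
  assumes "C \<subseteq> topspace Y" "y \<in> Y closure_of C"
  obtains C0 where "C0 \<subseteq> C" "|C0| \<le>o tightness_at Y y" "y \<in> Y closure_of C0"
proof -
  let ?S = "{M :: 'a set. \<forall>C. C \<subseteq> topspace Y \<and> y \<in> Y closure_of C \<longrightarrow>
       (\<exists>C0\<subseteq>C. |C0| \<le>o |M| \<and> y \<in> Y closure_of C0)}"
  have "UNIV \<in> ?S"
  proof (intro CollectI allI impI, elim conjE)
    fix C assume "y \<in> Y closure_of C"
    then show "\<exists>C0\<subseteq>C. |C0| \<le>o |UNIV :: 'a set| \<and> y \<in> Y closure_of C0"
      by (intro exI[of _ C] conjI subset_refl card_of_mono1[OF subset_UNIV])
  qed
  then have "?S \<noteq> {}" by (metis empty_iff)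
  from natLeq_csum_min_card_witness[OF this] obtain M
    where M: "M \<in> ?S" "|M| \<le>o tightness_at Y y" unfolding tightness_at_def .
  from M(1) assms obtain C0 where C0: "C0 \<subseteq> C" "|C0| \<le>o |M|" "y \<in> Y closure_of C0"
    by (elim CollectE allE impE conjE exE) auto
  show thesis by (rule that[OF C0(1) ordLeq_transitive[OF C0(2) M(2)] C0(3)])
qed

section \<open>Uniform convergence along filters attached to a bornology\<close>

lemma pos_cont_funsD:
  assumes "\<epsilon> \<in> pos_cont_funs"
  shows "continuous_on UNIV \<epsilon>" "0 < \<epsilon> x"
  using assms by (simp_all add: pos_cont_funs_def cont_funs_def)

lemma reciprocal_in_pos_cont_funs:
  "g \<in> cont_funs \<Longrightarrow> (\<lambda>x. 1 / max (g x) 1) \<in> pos_cont_funs"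
  unfolding pos_cont_funs_def cont_funs_def by (auto intro!: continuous_intros)

text \<open>What a set of error functions needs in order to induce a uniformity: minima give
  intersections of entourages, halves give the triangle inequality.\<close>

definition tolerances :: "('a::metric_space \<Rightarrow> real) set \<Rightarrow> bool" where
  "tolerances W \<longleftrightarrow> W \<noteq> {} \<and> W \<subseteq> pos_cont_funs \<and>
     (\<forall>\<epsilon>\<in>W. \<forall>\<epsilon>'\<in>W. (\<lambda>x. min (\<epsilon> x) (\<epsilon>' x)) \<in> W) \<and> (\<forall>\<epsilon>\<in>W. (\<lambda>x. \<epsilon> x / 2) \<in> W)"

definition const_tolerances :: "('a::metric_space \<Rightarrow> real) set" where
  "const_tolerances = {(\<lambda>_. c) | c. 0 < c}"

lemma tolerances_pos_cont_funs: "tolerances pos_cont_funs"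
  unfolding tolerances_def
  by (auto intro: pos_cont_funs_min pos_cont_funs_const[of 1])
    (auto simp: pos_cont_funs_def cont_funs_def intro!: continuous_intros)

lemma tolerances_const: "tolerances const_tolerances"
  unfolding tolerances_def const_tolerances_def using pos_cont_funs_const
  by (auto intro: exI[of _ 1])

lemma Collect_const_tolerances:
  "{X B \<epsilon> | B \<epsilon>. B \<in> \<B> \<and> \<epsilon> \<in> const_tolerances} = {X B (\<lambda>_. c) | B c. B \<in> \<B> \<and> 0 < c}"
  unfolding const_tolerances_def by blast

text \<open>Members of the bornology enter convergence only through the filters \<open>\<Phi> B\<close>. The assumption
  \<open>separation\<close> is a form of Urysohn's lemma strong enough that the separating function vanishes in
  the sense of the filter of \<open>A\<close>, hence on an entire enlargement of \<open>A\<close> in the strong case.\<close>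

locale filtered_bornology =
  fixes \<B> :: "'a::metric_space set set" and \<Phi> :: "'a set \<Rightarrow> 'a filter"
  assumes nonempty: "\<B> \<noteq> {}"
    and Un_closed: "B \<in> \<B> \<Longrightarrow> B' \<in> \<B> \<Longrightarrow> B \<union> B' \<in> \<B>"
    and closed_superset: "B \<in> \<B> \<Longrightarrow> \<exists>A\<in>\<B>. closed A \<and> B \<subseteq> A"
    and filter_mono: "B \<subseteq> B' \<Longrightarrow> \<Phi> B \<le> \<Phi> B'"
    and eventually_at_point: "eventually P (\<Phi> B) \<Longrightarrow> x \<in> B \<Longrightarrow> P x"
    and separation: "A \<in> \<B> \<Longrightarrow> closed A \<Longrightarrow> x \<notin> A \<Longrightarrow>
      \<exists>h\<in>cont_funs. h x = 1 \<and> eventually (\<lambda>y. h y = 0) (\<Phi> A)"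
begin

definition near :: "'a set \<Rightarrow> ('a \<Rightarrow> real) \<Rightarrow> ('a \<Rightarrow> real) \<Rightarrow> ('a \<Rightarrow> real) set" where
  "near B \<epsilon> f = {g \<in> cont_funs. eventually (\<lambda>x. \<bar>f x - g x\<bar> < \<epsilon> x) (\<Phi> B)}"

definition filter_entourages :: "('a \<Rightarrow> real) set \<Rightarrow> (('a \<Rightarrow> real) \<times> ('a \<Rightarrow> real)) set set" where
  "filter_entourages W = {{(f, g). f \<in> cont_funs \<and> g \<in> cont_funs \<and>
     eventually (\<lambda>x. \<bar>f x - g x\<bar> < \<epsilon> x) (\<Phi> B)} | B \<epsilon>. B \<in> \<B> \<and> \<epsilon> \<in> W}"

definition filter_topology :: "('a \<Rightarrow> real) set \<Rightarrow> ('a \<Rightarrow> real) topology" where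
  "filter_topology W = uniform_topology cont_funs (filter_entourages W)"

definition filter_dominating :: "('a \<Rightarrow> real) set \<Rightarrow> bool" where
  "filter_dominating F \<longleftrightarrow> F \<subseteq> cont_funs \<and>
     (\<forall>f\<in>cont_funs. \<forall>B\<in>\<B>. \<exists>g\<in>F. eventually (\<lambda>x. f x \<le> g x) (\<Phi> B))"

definition filter_dn :: "(nat + ('a \<Rightarrow> real)) rel" where
  "filter_dn = natLeq +c min_card {F. filter_dominating F}"

lemma nearI:
  "g \<in> cont_funs \<Longrightarrow> eventually (\<lambda>x. \<bar>f x - g x\<bar> < \<epsilon> x) (\<Phi> B) \<Longrightarrow> g \<in> near B \<epsilon> f"
  unfolding near_def by simp

lemma nearD: "g \<in> near B \<epsilon> f \<Longrightarrow> eventually (\<lambda>x. \<bar>f x - g x\<bar> < \<epsilon> x) (\<Phi> B)"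
  unfolding near_def by simp

lemma filter_entourages_const:
  "filter_entourages const_tolerances = {{(f, g). f \<in> cont_funs \<and> g \<in> cont_funs \<and>
     eventually (\<lambda>x. \<bar>f x - g x\<bar> < c) (\<Phi> B)} | B c. B \<in> \<B> \<and> 0 < c}"
  unfolding filter_entourages_def
  by (rule Collect_const_tolerances[of "\<lambda>B \<epsilon>. {(f, g). f \<in> cont_funs \<and> g \<in> cont_funs \<and>
     eventually (\<lambda>x. \<bar>f x - g x\<bar> < \<epsilon> x) (\<Phi> B)}"])

lemma near_mono:
  assumes "B' \<subseteq> B" "eventually (\<lambda>x. \<epsilon> x \<le> \<epsilon>' x) (\<Phi> B)"
  shows "near B \<epsilon> f \<subseteq> near B' \<epsilon>' f"
proof
  fix g assume g: "g \<in> near B \<epsilon> f"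
  have "eventually (\<lambda>x. \<bar>f x - g x\<bar> < \<epsilon>' x) (\<Phi> B)"
    using assms(2) g unfolding near_def by (auto elim: eventually_elim2)
  then show "g \<in> near B' \<epsilon>' f"
    using g filter_leD[OF filter_mono[OF assms(1)]] unfolding near_def by auto
qed

lemma near_triangle:
  assumes "g \<in> near B (\<lambda>x. \<epsilon> x / 2) f"
  shows "near B (\<lambda>x. \<epsilon> x / 2) g \<subseteq> near B \<epsilon> f"
proof
  fix h assume h: "h \<in> near B (\<lambda>x. \<epsilon> x / 2) g"
  have "eventually (\<lambda>x. \<bar>f x - g x\<bar> < \<epsilon> x / 2) (\<Phi> B)" "eventually (\<lambda>x. \<bar>g x - h x\<bar> < \<epsilon> x / 2) (\<Phi> B)"
    using assms h unfolding near_def by auto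
  then have "eventually (\<lambda>x. \<bar>f x - h x\<bar> < \<epsilon> x) (\<Phi> B)" by eventually_elim linarith
  then show "h \<in> near B \<epsilon> f" using h unfolding near_def by auto
qed

lemma self_in_near: "f \<in> cont_funs \<Longrightarrow> \<epsilon> \<in> pos_cont_funs \<Longrightarrow> f \<in> near B \<epsilon> f"
  unfolding near_def by (simp add: pos_cont_funsD)

lemma near_Int:
  "near (B \<union> B') (\<lambda>x. min (\<epsilon> x) (\<epsilon>' x)) f \<subseteq> near B \<epsilon> f \<inter> near B' \<epsilon>' f"
  by (intro Int_greatest near_mono) auto

lemma filter_entourages_directed:
  assumes W: "tolerances W" and E: "E \<in> filter_entourages W" "E' \<in> filter_entourages W"
  shows "\<exists>E''\<in>filter_entourages W. E'' \<subseteq> E \<inter> E'"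
proof -
  have sections: "{(f, g). f \<in> cont_funs \<and> g \<in> cont_funs \<and>
      eventually (\<lambda>x. \<bar>f x - g x\<bar> < \<epsilon> x) (\<Phi> B)} = {(f, g). f \<in> cont_funs \<and> g \<in> near B \<epsilon> f}"
    for \<epsilon> B by (auto simp: near_def)
  have mem: "E \<in> filter_entourages W \<longleftrightarrow>
      (\<exists>B \<epsilon>. E = {(f, g). f \<in> cont_funs \<and> g \<in> near B \<epsilon> f} \<and> B \<in> \<B> \<and> \<epsilon> \<in> W)" for E
    unfolding filter_entourages_def sections by (rule mem_Collect_eq)
  obtain B \<epsilon> where B: "E = {(f, g). f \<in> cont_funs \<and> g \<in> near B \<epsilon> f}" "B \<in> \<B>" "\<epsilon> \<in> W"
    using E(1) unfolding mem by (elim exE conjE)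
  obtain B' \<epsilon>' where B': "E' = {(f, g). f \<in> cont_funs \<and> g \<in> near B' \<epsilon>' f}" "B' \<in> \<B>" "\<epsilon>' \<in> W"
    using E(2) unfolding mem by (elim exE conjE)
  have "B \<union> B' \<in> \<B>" "(\<lambda>x. min (\<epsilon> x) (\<epsilon>' x)) \<in> W"
    using B B' W Un_closed unfolding tolerances_def by auto
  then have "{(f, g). f \<in> cont_funs \<and> g \<in> near (B \<union> B') (\<lambda>x. min (\<epsilon> x) (\<epsilon>' x)) f} \<in> filter_entourages W"
    unfolding mem by (intro exI conjI) (rule refl)
  moreover have "{(f, g). f \<in> cont_funs \<and> g \<in> near (B \<union> B') (\<lambda>x. min (\<epsilon> x) (\<epsilon>' x)) f} \<subseteq> E \<inter> E'"
    unfolding B(1) B'(1) using near_Int[of B B' \<epsilon> \<epsilon>'] by auto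
  ultimately show ?thesis by blast
qed

lemma openin_filter_topology:
  assumes "tolerances W"
  shows "openin (filter_topology W) U \<longleftrightarrow>
    U \<subseteq> cont_funs \<and> (\<forall>f\<in>U. \<exists>B\<in>\<B>. \<exists>\<epsilon>\<in>W. near B \<epsilon> f \<subseteq> U)"
proof -
  have sections: "(\<exists>E\<in>filter_entourages W. E `` {f} \<subseteq> U) \<longleftrightarrow> (\<exists>B\<in>\<B>. \<exists>\<epsilon>\<in>W. near B \<epsilon> f \<subseteq> U)"
    if "f \<in> cont_funs" for f
  proof -
    define E where "E B \<epsilon> = {(f, g). f \<in> cont_funs \<and> g \<in> cont_funs \<and>
      eventually (\<lambda>x. \<bar>f x - g x\<bar> < \<epsilon> x) (\<Phi> B)}" for B and \<epsilon> :: "'a \<Rightarrow> real"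
    have "E B \<epsilon> `` {f} = near B \<epsilon> f" for B \<epsilon>
      using that by (auto simp: near_def E_def)
    moreover have "filter_entourages W = {E B \<epsilon> | B \<epsilon>. B \<in> \<B> \<and> \<epsilon> \<in> W}"
      unfolding filter_entourages_def E_def ..
    ultimately have "(\<exists>E\<in>filter_entourages W. E `` {f} \<subseteq> U) \<longleftrightarrow>
        (\<exists>B \<epsilon>. (B \<in> \<B> \<and> \<epsilon> \<in> W) \<and> near B \<epsilon> f \<subseteq> U)"
      by (simp only: bex_simps mem_Collect_eq Bex_def) metis
    then show ?thesis by blast
  qed
  have opens: "openin (filter_topology W) U \<longleftrightarrow>
      U \<subseteq> cont_funs \<and> (\<forall>f\<in>U. \<exists>E\<in>filter_entourages W. E `` {f} \<subseteq> U)"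
    unfolding filter_topology_def
    by (rule openin_uniform_topology) (rule filter_entourages_directed[OF assms])
  show ?thesis unfolding opens
    by (rule conj_cong[OF refl]) (rule ball_cong[OF refl], rule sections, erule (1) subsetD)
qed

lemma topspace_filter_topology:
  assumes "tolerances W"
  shows "topspace (filter_topology W) = cont_funs"
  unfolding filter_topology_def
  using assms nonempty
  by (intro topspace_uniform_topology[OF filter_entourages_directed[OF assms]])
    (auto simp: filter_entourages_def tolerances_def)

text \<open>The sets \<open>near B \<epsilon> f\<close> need not be open: for constant \<open>\<epsilon>\<close> the gap between \<open>\<bar>f - g\<bar>\<close> and \<open>\<epsilon>\<close> may
  have infimum zero on \<open>B\<close>, and then functions uniformly close to \<open>g\<close> can leave the set.\<close>

definition near_interior :: "('a \<Rightarrow> real) set \<Rightarrow> 'a set \<Rightarrow> ('a \<Rightarrow> real) \<Rightarrow> ('a \<Rightarrow> real) \<Rightarrow> ('a \<Rightarrow> real) set"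
  where "near_interior W B \<epsilon> f =
    {g \<in> cont_funs. \<exists>B'\<in>\<B>. \<exists>\<epsilon>'\<in>W. near B' \<epsilon>' g \<subseteq> near B \<epsilon> f}"

lemma near_interior:
  assumes W: "tolerances W" and f: "f \<in> cont_funs" and B: "B \<in> \<B>" and \<epsilon>: "\<epsilon> \<in> W"
  shows "openin (filter_topology W) (near_interior W B \<epsilon> f)" "f \<in> near_interior W B \<epsilon> f"
    "near_interior W B \<epsilon> f \<subseteq> near B \<epsilon> f"
proof -
  show "f \<in> near_interior W B \<epsilon> f" unfolding near_interior_def using f B \<epsilon> by blast
  show "near_interior W B \<epsilon> f \<subseteq> near B \<epsilon> f"
    unfolding near_interior_def using self_in_near W unfolding tolerances_def by blast
  have "\<exists>B\<^sub>1\<in>\<B>. \<exists>\<epsilon>\<^sub>1\<in>W. near B\<^sub>1 \<epsilon>\<^sub>1 g \<subseteq> near_interior W B \<epsilon> f"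
    if g_in: "g \<in> near_interior W B \<epsilon> f" for g
  proof -
    obtain B' \<epsilon>' where g: "B' \<in> \<B>" "\<epsilon>' \<in> W" "near B' \<epsilon>' g \<subseteq> near B \<epsilon> f"
      using g_in unfolding near_interior_def by blast
    have half: "(\<lambda>x. \<epsilon>' x / 2) \<in> W" using W g(2) unfolding tolerances_def by blast
    have "near B' (\<lambda>x. \<epsilon>' x / 2) g \<subseteq> near_interior W B \<epsilon> f"
    proof
      fix h assume h: "h \<in> near B' (\<lambda>x. \<epsilon>' x / 2) g"
      have "near B' (\<lambda>x. \<epsilon>' x / 2) h \<subseteq> near B \<epsilon> f" using near_triangle[OF h] g(3) by blast
      moreover have "h \<in> cont_funs" using h unfolding near_def by blast
      ultimately show "h \<in> near_interior W B \<epsilon> f"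
        using half g(1) unfolding near_interior_def by blast
    qed
    then show ?thesis using g(1) half by blast
  qed
  then show "openin (filter_topology W) (near_interior W B \<epsilon> f)"
    unfolding openin_filter_topology[OF W] unfolding near_interior_def by blast
qed

lemma in_closure_of_filter_topology:
  assumes W: "tolerances W" and f: "f \<in> cont_funs"
  shows "f \<in> filter_topology W closure_of C \<longleftrightarrow> (\<forall>B\<in>\<B>. \<forall>\<epsilon>\<in>W. C \<inter> near B \<epsilon> f \<noteq> {})"
proof
  assume *: "f \<in> filter_topology W closure_of C"
  show "\<forall>B\<in>\<B>. \<forall>\<epsilon>\<in>W. C \<inter> near B \<epsilon> f \<noteq> {}"
  proof (intro ballI)
    fix B \<epsilon> assume B: "B \<in> \<B>" "\<epsilon> \<in> W"
    obtain g where "g \<in> C" "g \<in> near_interior W B \<epsilon> f"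
      using * near_interior(1,2)[OF W f B] unfolding in_closure_of by blast
    then show "C \<inter> near B \<epsilon> f \<noteq> {}" using near_interior(3)[OF W f B] by blast
  qed
next
  assume *: "\<forall>B\<in>\<B>. \<forall>\<epsilon>\<in>W. C \<inter> near B \<epsilon> f \<noteq> {}"
  show "f \<in> filter_topology W closure_of C"
    unfolding in_closure_of topspace_filter_topology[OF W]
  proof (intro conjI f allI impI)
    fix U assume U: "f \<in> U \<and> openin (filter_topology W) U"
    then obtain B \<epsilon> where B: "B \<in> \<B>" "\<epsilon> \<in> W" "near B \<epsilon> f \<subseteq> U"
      unfolding openin_filter_topology[OF W] by blast
    with * have "C \<inter> near B \<epsilon> f \<noteq> {}" by blast
    with B(3) show "\<exists>g. g \<in> C \<and> g \<in> U" by blast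
  qed
qed

lemma closure_of_witness:
  assumes "tolerances W" "f \<in> cont_funs" "f \<in> filter_topology W closure_of C" "B \<in> \<B>" "\<epsilon> \<in> W"
  obtains g where "g \<in> C" "eventually (\<lambda>x. \<bar>f x - g x\<bar> < \<epsilon> x) (\<Phi> B)"
proof -
  have "C \<inter> near B \<epsilon> f \<noteq> {}" using assms in_closure_of_filter_topology by blast
  then obtain g where "g \<in> C" "g \<in> near B \<epsilon> f" by blast
  then show thesis using that nearD by blast
qed

section \<open>Character\<close>

text \<open>Local bases in terms of their indices. Asking for closed sets \<open>A\<close> costs
  nothing, since every member of the bornology is contained in a closed one, and makes separation
  from points outside \<open>A\<close> available.\<close>

definition cofinal_at :: "('a \<Rightarrow> real) set \<Rightarrow> ('a \<Rightarrow> real) \<Rightarrow> ('a set \<times> ('a \<Rightarrow> real)) set \<Rightarrow> bool" where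
  "cofinal_at W f I \<longleftrightarrow> I \<subseteq> {A \<in> \<B>. closed A} \<times> W \<and>
     (\<forall>B\<in>\<B>. \<forall>\<epsilon>\<in>W. \<exists>(A, \<eta>)\<in>I. near A \<eta> f \<subseteq> near B \<epsilon> f)"

lemma character_at_ordLeq_cofinal:
  assumes W: "tolerances W" and f: "f \<in> cont_funs" and r: "Cinfinite r"
    and I: "cofinal_at W f I" "|I| \<le>o r"
  shows "character_at (filter_topology W) f \<le>o r"
proof (rule character_at_ordLeq[OF r])
  let ?V = "(\<lambda>(A, \<eta>). near_interior W A \<eta> f) ` I"
  show "|?V| \<le>o r" by (rule card_of_image_bound[OF I(2)])
  have I': "A \<in> \<B>" "\<eta> \<in> W" if "(A, \<eta>) \<in> I" for A \<eta> using that I(1) unfolding cofinal_at_def by auto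
  show "local_base (filter_topology W) f ?V"
    unfolding local_base_def
  proof (intro conjI ballI allI impI)
    fix V assume "V \<in> ?V"
    then show "openin (filter_topology W) V" "f \<in> V" using near_interior(1,2)[OF W f I'] by auto
  next
    fix U assume U: "openin (filter_topology W) U \<and> f \<in> U"
    then obtain B \<epsilon> where B: "B \<in> \<B>" "\<epsilon> \<in> W" "near B \<epsilon> f \<subseteq> U"
      unfolding openin_filter_topology[OF W] by blast
    then obtain A \<eta> where A: "(A, \<eta>) \<in> I" "near A \<eta> f \<subseteq> near B \<epsilon> f"
      using I(1) unfolding cofinal_at_def by blast
    then have "near_interior W A \<eta> f \<subseteq> U" using near_interior(3)[OF W f I'[OF A(1)]] B(3) by blast
    with A(1) show "\<exists>V\<in>?V. V \<subseteq> U" by blast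
  qed
qed

lemma character_at_cofinal_witness:
  assumes W: "tolerances W" and f: "f \<in> cont_funs"
  obtains I where "cofinal_at W f I" "|I| \<le>o character_at (filter_topology W) f"
proof -
  obtain \<V> where \<V>: "local_base (filter_topology W) f \<V>"
    "|\<V>| \<le>o character_at (filter_topology W) f" by (rule character_at_witness)
  have "\<exists>p. fst p \<in> \<B> \<and> closed (fst p) \<and> snd p \<in> W \<and> near (fst p) (snd p) f \<subseteq> V"
    if V: "V \<in> \<V>" for V
  proof -
    have "openin (filter_topology W) V" "f \<in> V" using \<V>(1) V unfolding local_base_def by auto
    then obtain B \<epsilon> where B: "B \<in> \<B>" "\<epsilon> \<in> W" "near B \<epsilon> f \<subseteq> V"
      unfolding openin_filter_topology[OF W] by blast
    obtain A where A: "A \<in> \<B>" "closed A" "B \<subseteq> A" using closed_superset[OF B(1)] by blast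
    have "near A \<epsilon> f \<subseteq> V" using near_mono[OF A(3), of \<epsilon> \<epsilon> f] B(3) by auto
    then show ?thesis using A B by (intro exI[of _ "(A, \<epsilon>)"]) simp
  qed
  then obtain p where p: "\<And>V. V \<in> \<V> \<Longrightarrow> fst (p V) \<in> \<B> \<and> closed (fst (p V)) \<and> snd (p V) \<in> W \<and>
      near (fst (p V)) (snd (p V)) f \<subseteq> V" by metis
  have "cofinal_at W f (p ` \<V>)"
    unfolding cofinal_at_def
  proof (intro conjI ballI)
    show "p ` \<V> \<subseteq> {A \<in> \<B>. closed A} \<times> W" using p by (simp add: image_subset_iff mem_Times_iff)
    fix B \<epsilon> assume B: "B \<in> \<B>" "\<epsilon> \<in> W"
    obtain V where V: "V \<in> \<V>" "V \<subseteq> near B \<epsilon> f"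
      using near_interior[OF W f B] \<V>(1) unfolding local_base_def by (meson subset_trans)
    then show "\<exists>(A, \<eta>)\<in>p ` \<V>. near A \<eta> f \<subseteq> near B \<epsilon> f"
      using p[OF V(1)] by (auto simp: case_prod_beta)
  qed
  moreover have "|p ` \<V>| \<le>o character_at (filter_topology W) f"
    by (rule card_of_image_bound[OF \<V>(2)])
  ultimately show thesis by (rule that)
qed

text \<open>Adding to \<open>f\<close> a multiple of a function that vanishes along \<open>A\<close> does not leave the neighbourhood
  given by \<open>A\<close>, but may change the value at a point outside \<open>A\<close> arbitrarily.\<close>

lemma subset_if_near_subset:
  assumes f: "f \<in> cont_funs" and \<eta>: "\<eta> \<in> pos_cont_funs"
    and A: "A \<in> \<B>" "closed A" and sub: "near A \<eta> f \<subseteq> near B \<epsilon> f"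
  shows "B \<subseteq> A"
proof (rule ccontr)
  assume "\<not> B \<subseteq> A"
  then obtain x where x: "x \<in> B" "x \<notin> A" by blast
  obtain h where h: "h \<in> cont_funs" "h x = 1" "eventually (\<lambda>y. h y = 0) (\<Phi> A)"
    using separation[OF A x(2)] by blast
  let ?g = "\<lambda>y. f y + \<epsilon> x * h y"
  have "?g \<in> cont_funs" using f h(1) unfolding cont_funs_def by (auto intro!: continuous_intros)
  moreover have "eventually (\<lambda>y. \<bar>f y - ?g y\<bar> < \<eta> y) (\<Phi> A)"
    using h(3) by (rule eventually_mono) (simp add: pos_cont_funsD[OF \<eta>])
  ultimately have "?g \<in> near A \<eta> f" unfolding near_def by simp
  with sub have "?g \<in> near B \<epsilon> f" by (rule subsetD)
  from eventually_at_point[OF nearD[OF this] x(1)] have "\<bar>f x - ?g x\<bar> < \<epsilon> x" .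
  then show False using h(2) by simp
qed

lemma half_less_if_near_subset:
  assumes f: "f \<in> cont_funs" and \<eta>: "\<eta> \<in> pos_cont_funs" and sub: "near A \<eta> f \<subseteq> near B \<epsilon> f"
  shows "eventually (\<lambda>x. \<eta> x / 2 < \<epsilon> x) (\<Phi> B)"
proof -
  let ?g = "\<lambda>x. f x + \<eta> x / 2"
  have "?g \<in> cont_funs"
    using f pos_cont_funsD(1)[OF \<eta>] unfolding cont_funs_def by (auto intro!: continuous_intros)
  moreover have "\<bar>f x - ?g x\<bar> < \<eta> x" for x using pos_cont_funsD(2)[OF \<eta>, of x] by simp
  ultimately have "?g \<in> near A \<eta> f" unfolding near_def by simp
  then have "eventually (\<lambda>x. \<bar>f x - ?g x\<bar> < \<epsilon> x) (\<Phi> B)" using sub by (intro nearD) (rule subsetD)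
  then show ?thesis by (rule eventually_mono) auto
qed

lemma filter_dn_ordLeq:
  assumes "Cinfinite r" "filter_dominating F" "|F| \<le>o r"
  shows "filter_dn \<le>o r"
  unfolding filter_dn_def by (rule natLeq_csum_min_card_ordLeq[of r F]) (use assms in auto)

lemma filter_dn_witness:
  obtains F where "filter_dominating F" "|F| \<le>o filter_dn"
proof -
  have "filter_dominating cont_funs" unfolding filter_dominating_def
  proof (intro conjI ballI subset_refl)
    fix f :: "'a \<Rightarrow> real" and B assume "f \<in> cont_funs"
    then show "\<exists>g\<in>cont_funs. eventually (\<lambda>x. f x \<le> g x) (\<Phi> B)" by (rule bexI[rotated]) simp
  qed
  then have "{F. filter_dominating F} \<noteq> {}" by blast
  from natLeq_csum_min_card_witness[OF this] obtain F
    where "F \<in> {F. filter_dominating F}" "|F| \<le>o filter_dn"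
    unfolding filter_dn_def .
  then show thesis by (intro that) simp_all
qed

lemma Cinfinite_filter_dn: "Cinfinite filter_dn"
  unfolding filter_dn_def by (rule Cinfinite_natLeq_csum)

lemma filter_dominatingD:
  assumes "filter_dominating F" "f \<in> cont_funs" "B \<in> \<B>"
  shows "\<exists>g\<in>F. eventually (\<lambda>x. f x \<le> g x) (\<Phi> B)"
  using assms(1) unfolding filter_dominating_def
  by (rule bspec[OF bspec[OF conjunct2 assms(2)] assms(3)])

text \<open>Choose \<open>g\<close> dominating \<open>1 / \<epsilon>\<close>. The truncation at 1 makes the reciprocal continuous and positive
  everywhere, also where \<open>g\<close> is not, and it keeps the inequality because it only enlarges \<open>g\<close>.\<close>

lemma filter_dominating_reciprocal:
  assumes "filter_dominating F" "\<epsilon> \<in> pos_cont_funs" "B \<in> \<B>"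
  obtains g where "g \<in> F" "eventually (\<lambda>x. 1 / max (g x) 1 \<le> \<epsilon> x) (\<Phi> B)"
proof -
  note \<epsilon> = pos_cont_funsD[OF assms(2)]
  have "(\<lambda>x. 1 / \<epsilon> x) \<in> cont_funs"
    unfolding cont_funs_def using \<epsilon> by (auto intro!: continuous_intros simp: less_imp_neq[symmetric])
  from filter_dominatingD[OF assms(1) this assms(3)]
  obtain g where g: "g \<in> F" "eventually (\<lambda>x. 1 / \<epsilon> x \<le> g x) (\<Phi> B)" by (rule bexE)
  have le: "1 / max (g x) 1 \<le> \<epsilon> x" if "1 / \<epsilon> x \<le> g x" for x
  proof -
    have "1 / \<epsilon> x \<le> max (g x) 1" using that by simp
    then show ?thesis using \<epsilon>(2)[of x] by (simp add: field_simps)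
  qed
  have "eventually (\<lambda>x. 1 / max (g x) 1 \<le> \<epsilon> x) (\<Phi> B)" using g(2) by (rule eventually_mono) (rule le)
  with g(1) show thesis by (rule that)
qed

lemma filter_dominating_reciprocalI:
  assumes P: "P \<subseteq> pos_cont_funs"
    and small: "\<And>\<epsilon> B. \<epsilon> \<in> pos_cont_funs \<Longrightarrow> B \<in> \<B> \<Longrightarrow> \<exists>\<eta>\<in>P. eventually (\<lambda>x. \<eta> x < \<epsilon> x) (\<Phi> B)"
  shows "filter_dominating ((\<lambda>\<eta> x. 1 / \<eta> x) ` P)"
  unfolding filter_dominating_def
proof (intro conjI ballI)
  show "(\<lambda>\<eta> x. 1 / \<eta> x) ` P \<subseteq> cont_funs"
  proof (rule image_subsetI)
    fix \<eta> assume "\<eta> \<in> P"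
    then have "\<eta> \<in> pos_cont_funs" using P by blast
    note \<eta> = pos_cont_funsD[OF this]
    show "(\<lambda>x. 1 / \<eta> x) \<in> cont_funs"
      unfolding cont_funs_def using \<eta> by (auto intro!: continuous_intros simp: less_imp_neq[symmetric])
  qed
  fix f :: "'a \<Rightarrow> real" and B assume f: "f \<in> cont_funs" and B: "B \<in> \<B>"
  obtain \<eta> where \<eta>: "\<eta> \<in> P" "eventually (\<lambda>x. \<eta> x < 1 / max (f x) 1) (\<Phi> B)"
    using small[OF reciprocal_in_pos_cont_funs[OF f] B] by blast
  have pos: "0 < \<eta> x" for x using \<eta>(1) P pos_cont_funsD(2) by blast
  have le: "f x \<le> 1 / \<eta> x" if "\<eta> x < 1 / max (f x) 1" for x
  proof -
    have "max (f x) 1 < 1 / \<eta> x" using that pos[of x] by (simp add: less_divide_eq mult.commute)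
    then show ?thesis by simp
  qed
  have "eventually (\<lambda>x. f x \<le> 1 / \<eta> x) (\<Phi> B)" using \<eta>(2) by (rule eventually_mono) (rule le)
  then show "\<exists>g\<in>(\<lambda>\<eta> x. 1 / \<eta> x) ` P. eventually (\<lambda>x. f x \<le> g x) (\<Phi> B)"
    by (rule bexI[of _ "\<lambda>x. 1 / \<eta> x"]) (rule imageI[OF \<eta>(1)])
qed

lemma filter_dn_ordLeq_reciprocal:
  assumes "Cinfinite r" "|P| \<le>o r" "P \<subseteq> pos_cont_funs"
    "\<And>\<epsilon> B. \<epsilon> \<in> pos_cont_funs \<Longrightarrow> B \<in> \<B> \<Longrightarrow> \<exists>\<eta>\<in>P. eventually (\<lambda>x. \<eta> x < \<epsilon> x) (\<Phi> B)"
  shows "filter_dn \<le>o r"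
  by (rule filter_dn_ordLeq[OF assms(1) filter_dominating_reciprocalI[OF assms(3,4)]
        card_of_image_bound[OF assms(2)]])

abbreviation "fine_topology \<equiv> filter_topology pos_cont_funs"
abbreviation "coarse_topology \<equiv> filter_topology const_tolerances"

lemma const_tolerances_D:
  assumes "\<epsilon> \<in> const_tolerances"
  shows "\<epsilon> \<in> pos_cont_funs" "\<exists>c>0. \<epsilon> = (\<lambda>_. c)"
  using assms pos_cont_funs_const unfolding const_tolerances_def by auto

lemma const_tolerances_I: "0 < c \<Longrightarrow> (\<lambda>_. c) \<in> const_tolerances"
  unfolding const_tolerances_def by blast

lemma product_bound:
  assumes "Cinfinite r" "Cinfinite k" "filter_dn \<le>o r" "k \<le>o r"
  shows "filter_dn *c k \<le>o r"
  using cprod_cinfinite_bound[OF assms(3,4)] assms(1,2) Cinfinite_filter_dn by blast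

lemma ordLeq_product:
  assumes "Cinfinite k"
  shows "filter_dn \<le>o filter_dn *c k" "k \<le>o filter_dn *c k" "Cinfinite (filter_dn *c k)"
  using assms Cinfinite_filter_dn
  by (auto intro!: ordLeq_cprod_left ordLeq_cprod2 Cinfinite_cprod2 Cinfinite_Cnotzero)

lemma character_at_fine_upper:
  assumes f: "f \<in> cont_funs"
  shows "character_at fine_topology f \<le>o filter_dn *c character_at coarse_topology f"
    (is "_ \<le>o ?r")
proof -
  note r = ordLeq_product[OF Cinfinite_character_at[of coarse_topology f]]
  obtain I where I: "cofinal_at const_tolerances f I" "|I| \<le>o character_at coarse_topology f"
    by (rule character_at_cofinal_witness[OF tolerances_const f])
  obtain F where F: "filter_dominating F" "|F| \<le>o filter_dn" by (rule filter_dn_witness)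
  let ?J = "(\<lambda>(p, g). (fst p, \<lambda>x. 1 / max (g x) 1)) ` (I \<times> F)"
  have "|?J| \<le>o ?r"
    by (rule card_of_image_bound[OF card_of_Times_Cinfinite_bound[OF r(3)
          ordLeq_transitive[OF I(2) r(2)] ordLeq_transitive[OF F(2) r(1)]]])
  moreover have "cofinal_at pos_cont_funs f ?J"
    unfolding cofinal_at_def
  proof (intro conjI ballI)
    show "?J \<subseteq> {A \<in> \<B>. closed A} \<times> pos_cont_funs"
    proof (rule image_subsetI)
      fix q assume "q \<in> I \<times> F"
      then obtain A \<eta> g where q: "q = ((A, \<eta>), g)" "(A, \<eta>) \<in> I" "g \<in> F" by (cases q) auto
      have "g \<in> cont_funs" using F(1) q(3) unfolding filter_dominating_def by (elim conjE) (rule subsetD)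
      moreover have "A \<in> {A \<in> \<B>. closed A}" using I(1) q(2) unfolding cofinal_at_def by auto
      ultimately show "(case q of (p, g) \<Rightarrow> (fst p, \<lambda>x. 1 / max (g x) 1)) \<in> {A \<in> \<B>. closed A} \<times> pos_cont_funs"
        using reciprocal_in_pos_cont_funs by (simp add: q(1))
    qed
    fix B and \<epsilon> :: "'a \<Rightarrow> real" assume B: "B \<in> \<B>" and \<epsilon>: "\<epsilon> \<in> pos_cont_funs"
    \<comment> \<open>Tolerance 1 is an arbitrary choice: only the inclusion \<open>B \<subseteq> A\<close> is read off from it.\<close>
    have "(\<lambda>_. 1) \<in> const_tolerances" by (simp add: const_tolerances_I)
    then obtain A \<eta> where A: "(A, \<eta>) \<in> I" "near A \<eta> f \<subseteq> near B (\<lambda>_. 1) f"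
      using I(1) B unfolding cofinal_at_def by blast
    have A': "A \<in> \<B>" "closed A" "\<eta> \<in> pos_cont_funs"
      using I(1) A(1) const_tolerances_D unfolding cofinal_at_def by auto
    have sub: "B \<subseteq> A" by (rule subset_if_near_subset[OF f A'(3,1,2) A(2)])
    obtain g where g: "g \<in> F" "eventually (\<lambda>x. 1 / max (g x) 1 \<le> \<epsilon> x) (\<Phi> A)"
      by (rule filter_dominating_reciprocal[OF F(1) \<epsilon> A'(1)])
    show "\<exists>(A, \<eta>)\<in>?J. near A \<eta> f \<subseteq> near B \<epsilon> f"
      using near_mono[OF sub g(2)] A(1) g(1)
      by (intro bexI[of _ "(A, \<lambda>x. 1 / max (g x) 1)"] image_eqI[of _ _ "((A, \<eta>), g)"]) simp_all
  qed
  ultimately show ?thesis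
    by (rule character_at_ordLeq_cofinal[OF tolerances_pos_cont_funs f r(3), rotated])
qed

lemma character_at_fine_lower:
  assumes f: "f \<in> cont_funs"
  shows "filter_dn \<le>o character_at fine_topology f"
    and "character_at coarse_topology f \<le>o character_at fine_topology f"
proof -
  let ?r = "character_at fine_topology f"
  obtain I where I: "cofinal_at pos_cont_funs f I" "|I| \<le>o ?r"
    by (rule character_at_cofinal_witness[OF tolerances_pos_cont_funs f])
  have I': "A \<in> \<B>" "closed A" "\<eta> \<in> pos_cont_funs" if "(A, \<eta>) \<in> I" for A \<eta>
    using I(1) that unfolding cofinal_at_def by auto
  show "filter_dn \<le>o ?r"
  proof (rule filter_dn_ordLeq_reciprocal[OF Cinfinite_character_at])
    \<comment> \<open>The inequality \<open>\<bar>f - g\<bar> < \<eta>\<close> is strict, so \<open>f + \<eta>\<close> is not near \<open>f\<close>, whereas \<open>f + \<eta> / 2\<close> is.\<close>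
    let ?P = "(\<lambda>p x. snd p x / 2) ` I"
    show "|?P| \<le>o ?r" by (rule card_of_image_bound[OF I(2)])
    show "?P \<subseteq> pos_cont_funs"
    proof (rule image_subsetI)
      fix p assume "p \<in> I"
      then have "snd p \<in> pos_cont_funs" using I'(3)[of "fst p" "snd p"] by simp
      then show "(\<lambda>x. snd p x / 2) \<in> pos_cont_funs"
        using tolerances_pos_cont_funs unfolding tolerances_def by blast
    qed
    fix \<epsilon> :: "'a \<Rightarrow> real" and B assume \<epsilon>: "\<epsilon> \<in> pos_cont_funs" "B \<in> \<B>"
    then obtain A \<eta> where A: "(A, \<eta>) \<in> I" "near A \<eta> f \<subseteq> near B \<epsilon> f"
      using I(1) unfolding cofinal_at_def by blast
    show "\<exists>\<eta>\<in>?P. eventually (\<lambda>x. \<eta> x < \<epsilon> x) (\<Phi> B)"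
      using half_less_if_near_subset[OF f I'(3)[OF A(1)] A(2)] A(1)
      by (intro bexI[of _ "\<lambda>x. \<eta> x / 2"] image_eqI[of _ _ "(A, \<eta>)"]) simp_all
  qed
  let ?J = "(\<lambda>(p, n). (fst p, \<lambda>_. 1 / real (Suc n))) ` (I \<times> UNIV)"
  have "|?J| \<le>o ?r"
    by (intro card_of_image_bound card_of_Times_Cinfinite_bound Cinfinite_character_at I(2) card_of_nat_bound)
  moreover have "cofinal_at const_tolerances f ?J"
    unfolding cofinal_at_def
  proof (intro conjI ballI)
    show "?J \<subseteq> {A \<in> \<B>. closed A} \<times> const_tolerances"
      using I' by (auto intro!: const_tolerances_I)
    fix B and \<epsilon> :: "'a \<Rightarrow> real" assume B: "B \<in> \<B>" and \<epsilon>: "\<epsilon> \<in> const_tolerances"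
    obtain A \<eta> where A: "(A, \<eta>) \<in> I" "near A \<eta> f \<subseteq> near B \<epsilon> f"
      using I(1) B const_tolerances_D(1)[OF \<epsilon>] unfolding cofinal_at_def by blast
    have sub: "B \<subseteq> A" by (rule subset_if_near_subset[OF f I'(3,1,2)[OF A(1)] A(2)])
    obtain c where c: "0 < c" "\<epsilon> = (\<lambda>_. c)" using const_tolerances_D(2)[OF \<epsilon>] by blast
    obtain n where "1 / real (Suc n) < c" using nat_approx_posE[OF c(1)] by blast
    then have "near A (\<lambda>_. 1 / real (Suc n)) f \<subseteq> near B \<epsilon> f"
      unfolding c(2) by (intro near_mono[OF sub]) simp
    then show "\<exists>(A, \<eta>)\<in>?J. near A \<eta> f \<subseteq> near B \<epsilon> f"
      using A(1) by (intro bexI[of _ "(A, \<lambda>_. 1 / real (Suc n))"] image_eqI[of _ _ "((A, \<eta>), n)"]) simp_all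
  qed
  ultimately show "character_at coarse_topology f \<le>o ?r"
    by (rule character_at_ordLeq_cofinal[OF tolerances_const f Cinfinite_character_at, rotated])
qed

section \<open>Tightness\<close>

text \<open>Tightness applied to \<open>\<Theta> ` C\<close> yields a small subset of \<open>\<Theta> ` C\<close>; choosing one preimage for each of its
  elements gives a subset of \<open>C\<close> that is just as small. To compare the two tightnesses, let \<open>f\<close> lie in the closure of
  \<open>C\<close> for one of the two topologies and in that of \<open>\<Theta> ` C\<close> for the other, so that the tightness of the
  second is turned into information about the first.\<close>

lemma pullback_small_subset:
  assumes W: "tolerances W" and f: "f \<in> cont_funs"
    and cont: "\<Theta> ` C \<subseteq> cont_funs"
    and cl: "\<And>B \<epsilon>. B \<in> \<B> \<Longrightarrow> \<epsilon> \<in> W \<Longrightarrow> \<exists>h\<in>C. eventually (\<lambda>x. \<bar>f x - \<Theta> h x\<bar> < \<epsilon> x) (\<Phi> B)"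
  shows "\<exists>C0. C0 \<subseteq> C \<and> |C0| \<le>o tightness_at (filter_topology W) f \<and>
    (\<forall>B\<in>\<B>. \<forall>\<epsilon>\<in>W. \<exists>h\<in>C0. eventually (\<lambda>x. \<bar>f x - \<Theta> h x\<bar> < \<epsilon> x) (\<Phi> B))"
proof -
  have "f \<in> filter_topology W closure_of (\<Theta> ` C)"
    unfolding in_closure_of_filter_topology[OF W f]
  proof (intro ballI)
    fix B \<epsilon> assume "B \<in> \<B>" "\<epsilon> \<in> W"
    from cl[OF this] obtain h where h: "h \<in> C" "eventually (\<lambda>x. \<bar>f x - \<Theta> h x\<bar> < \<epsilon> x) (\<Phi> B)"
      by (rule bexE)
    then have "\<Theta> h \<in> near B \<epsilon> f" using cont by (intro nearI) auto
    then show "\<Theta> ` C \<inter> near B \<epsilon> f \<noteq> {}" using h(1) by blast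
  qed
  then obtain D where D: "D \<subseteq> \<Theta> ` C" "|D| \<le>o tightness_at (filter_topology W) f"
    "f \<in> filter_topology W closure_of D"
    by (rule tightness_at_witness[rotated]) (simp_all add: topspace_filter_topology[OF W] cont)
  obtain C0 where C0: "C0 \<subseteq> C" "inj_on \<Theta> C0" "\<Theta> ` C0 = D"
    using subset_image_inj[of D \<Theta> C] D(1) by auto
  have "|C0| =o |D|"
    unfolding C0(3)[symmetric] by (rule card_of_ordIsoI[OF inj_on_imp_bij_betw[OF C0(2)]])
  then have "|C0| \<le>o tightness_at (filter_topology W) f" by (rule ordIso_ordLeq_trans[OF _ D(2)])
  moreover have "\<exists>h\<in>C0. eventually (\<lambda>x. \<bar>f x - \<Theta> h x\<bar> < \<epsilon> x) (\<Phi> B)"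
    if B: "B \<in> \<B>" "\<epsilon> \<in> W" for B \<epsilon>
  proof -
    obtain g where g: "g \<in> \<Theta> ` C0" "eventually (\<lambda>x. \<bar>f x - g x\<bar> < \<epsilon> x) (\<Phi> B)"
      using closure_of_witness[OF W f D(3) B] unfolding C0(3) .
    obtain h where h: "g = \<Theta> h" "h \<in> C0" using g(1) by (rule imageE)
    show ?thesis using g(2) unfolding h(1) by (rule bexI[OF _ h(2)])
  qed
  ultimately show ?thesis by (intro exI[of _ C0] conjI ballI C0(1))
qed

text \<open>In the fine topology \<open>f\<close> is in the closure of the functions strictly above \<open>f\<close>. If it is in the
  closure of \<open>f + P\<close> for a set \<open>P\<close> of positive functions, then \<open>P\<close> gets below every tolerance.\<close>

lemma tightness_at_fine_ge_dn:
  assumes f: "f \<in> cont_funs"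
  shows "filter_dn \<le>o tightness_at fine_topology f"
proof -
  let ?\<Theta> = "\<lambda>\<eta> x. f x + \<eta> x"
  have "?\<Theta> ` pos_cont_funs \<subseteq> cont_funs"
    using f by (auto simp: cont_funs_def pos_cont_funs_def intro!: continuous_intros)
  moreover have "\<exists>\<eta>\<in>pos_cont_funs. eventually (\<lambda>x. \<bar>f x - ?\<Theta> \<eta> x\<bar> < \<epsilon> x) (\<Phi> B)"
    if "\<epsilon> \<in> pos_cont_funs" for B and \<epsilon> :: "'a \<Rightarrow> real"
  proof (rule bexI)
    show "(\<lambda>x. \<epsilon> x / 2) \<in> pos_cont_funs"
      using that tolerances_pos_cont_funs unfolding tolerances_def by blast
    show "eventually (\<lambda>x. \<bar>f x - ?\<Theta> (\<lambda>x. \<epsilon> x / 2) x\<bar> < \<epsilon> x) (\<Phi> B)"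
      using pos_cont_funsD(2)[OF that] by (simp add: abs_of_pos)
  qed
  ultimately have "\<exists>P. P \<subseteq> pos_cont_funs \<and> |P| \<le>o tightness_at fine_topology f \<and>
      (\<forall>B\<in>\<B>. \<forall>\<epsilon>\<in>pos_cont_funs. \<exists>\<eta>\<in>P. eventually (\<lambda>x. \<bar>f x - ?\<Theta> \<eta> x\<bar> < \<epsilon> x) (\<Phi> B))"
    by (rule pullback_small_subset[OF tolerances_pos_cont_funs f])
  then obtain P where P: "P \<subseteq> pos_cont_funs" "|P| \<le>o tightness_at fine_topology f"
    "\<forall>B\<in>\<B>. \<forall>\<epsilon>\<in>pos_cont_funs. \<exists>\<eta>\<in>P. eventually (\<lambda>x. \<bar>f x - ?\<Theta> \<eta> x\<bar> < \<epsilon> x) (\<Phi> B)"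
    by (elim exE conjE)
  show ?thesis
  proof (rule filter_dn_ordLeq_reciprocal[OF Cinfinite_tightness_at P(2,1)])
    fix \<epsilon> :: "'a \<Rightarrow> real" and B assume \<epsilon>: "\<epsilon> \<in> pos_cont_funs" and B: "B \<in> \<B>"
    obtain \<eta> where \<eta>: "\<eta> \<in> P" "eventually (\<lambda>x. \<bar>f x - ?\<Theta> \<eta> x\<bar> < \<epsilon> x) (\<Phi> B)"
      using bspec[OF bspec[OF P(3) B] \<epsilon>] by (elim bexE)
    have "eventually (\<lambda>x. \<eta> x < \<epsilon> x) (\<Phi> B)" using \<eta>(2) by (rule eventually_mono) auto
    with \<eta>(1) show "\<exists>\<eta>\<in>P. eventually (\<lambda>x. \<eta> x < \<epsilon> x) (\<Phi> B)" by blast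
  qed
qed

text \<open>If \<open>g\<close> is within \<open>1 / (n + 1)\<close> of \<open>f\<close> along \<open>B\<close>, its deformation \<open>\<Theta> n g\<close> equals \<open>f\<close> there, which is
  closeness for every tolerance at once. Conversely, if \<open>\<Theta> n g\<close> is within \<open>c / 2\<close> of \<open>f\<close> and
  \<open>1 / (n + 1) < c / 2\<close>, then \<open>g\<close> is within \<open>c\<close> of \<open>f\<close>. The union over \<open>n\<close> adds only a countable
  factor.\<close>

lemma tightness_at_coarse_le_fine:
  assumes f: "f \<in> cont_funs"
  shows "tightness_at coarse_topology f \<le>o tightness_at fine_topology f"
proof (rule tightness_at_ordLeq[OF Cinfinite_tightness_at])
  let ?r = "tightness_at fine_topology f"
  fix C assume C: "C \<subseteq> topspace coarse_topology" "f \<in> coarse_topology closure_of C"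
  have C': "C \<subseteq> cont_funs" using C(1) topspace_filter_topology[OF tolerances_const] by simp
  define \<Theta> where "\<Theta> n g = (\<lambda>x. f x + max (\<bar>f x - g x\<bar> - 1 / real (Suc n)) 0)" for n g
  have "\<forall>n. \<exists>C0. C0 \<subseteq> C \<and> |C0| \<le>o ?r \<and>
      (\<forall>B\<in>\<B>. \<forall>\<epsilon>\<in>pos_cont_funs. \<exists>g\<in>C0. eventually (\<lambda>x. \<bar>f x - \<Theta> n g x\<bar> < \<epsilon> x) (\<Phi> B))"
  proof
    fix n
    have "\<Theta> n ` C \<subseteq> cont_funs"
      using f C' unfolding \<Theta>_def cont_funs_def by (auto intro!: continuous_intros)
    moreover have "\<exists>g\<in>C. eventually (\<lambda>x. \<bar>f x - \<Theta> n g x\<bar> < \<epsilon> x) (\<Phi> B)"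
      if B: "B \<in> \<B>" and \<epsilon>: "\<epsilon> \<in> pos_cont_funs" for B and \<epsilon> :: "'a \<Rightarrow> real"
    proof -
      have "(\<lambda>_. 1 / real (Suc n)) \<in> const_tolerances" by (rule const_tolerances_I) simp
      then obtain g where g: "g \<in> C" "eventually (\<lambda>x. \<bar>f x - g x\<bar> < 1 / real (Suc n)) (\<Phi> B)"
        by (rule closure_of_witness[OF tolerances_const f C(2) B])
      have "eventually (\<lambda>x. \<bar>f x - \<Theta> n g x\<bar> < \<epsilon> x) (\<Phi> B)"
        using g(2) by (rule eventually_mono) (simp add: \<Theta>_def pos_cont_funsD(2)[OF \<epsilon>])
      with g(1) show ?thesis by blast
    qed
    ultimately show "\<exists>C0. C0 \<subseteq> C \<and> |C0| \<le>o ?r \<and>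
        (\<forall>B\<in>\<B>. \<forall>\<epsilon>\<in>pos_cont_funs. \<exists>g\<in>C0. eventually (\<lambda>x. \<bar>f x - \<Theta> n g x\<bar> < \<epsilon> x) (\<Phi> B))"
      by (rule pullback_small_subset[OF tolerances_pos_cont_funs f])
  qed
  from choice[OF this] obtain D where "\<forall>n. D n \<subseteq> C \<and> |D n| \<le>o ?r \<and>
      (\<forall>B\<in>\<B>. \<forall>\<epsilon>\<in>pos_cont_funs. \<exists>g\<in>D n. eventually (\<lambda>x. \<bar>f x - \<Theta> n g x\<bar> < \<epsilon> x) (\<Phi> B))"
    by (rule exE)
  note D = this[THEN spec, THEN conjunct1] this[THEN spec, THEN conjunct2, THEN conjunct1]
    this[THEN spec, THEN conjunct2, THEN conjunct2, THEN bspec, THEN bspec]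
  have "f \<in> coarse_topology closure_of (\<Union>n. D n)"
    unfolding in_closure_of_filter_topology[OF tolerances_const f]
  proof (intro ballI)
    fix B and \<epsilon> :: "'a \<Rightarrow> real" assume B: "B \<in> \<B>" and \<epsilon>: "\<epsilon> \<in> const_tolerances"
    obtain c where c: "0 < c" "\<epsilon> = (\<lambda>_. c)" using const_tolerances_D(2)[OF \<epsilon>] by blast
    have "0 < c / 2" using c(1) by simp
    then obtain n where n: "1 / real (Suc n) < c / 2" using nat_approx_posE by blast
    obtain g where g: "g \<in> D n" "eventually (\<lambda>x. \<bar>f x - \<Theta> n g x\<bar> < c / 2) (\<Phi> B)"
      using D(3)[OF B pos_cont_funs_const[OF \<open>0 < c / 2\<close>]] by (rule bexE)
    have "eventually (\<lambda>x. \<bar>f x - g x\<bar> < \<epsilon> x) (\<Phi> B)"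
      using g(2)
    proof (rule eventually_mono)
      fix x assume "\<bar>f x - \<Theta> n g x\<bar> < c / 2"
      then have "max (\<bar>f x - g x\<bar> - 1 / real (Suc n)) 0 < c / 2" unfolding \<Theta>_def by simp
      then have "\<bar>f x - g x\<bar> - 1 / real (Suc n) < c / 2" by (rule le_less_trans[OF max.cobounded1])
      then show "\<bar>f x - g x\<bar> < \<epsilon> x" unfolding c(2) using n by linarith
    qed
    moreover have "g \<in> cont_funs" using g(1) D(1) C' by blast
    ultimately have "g \<in> near B \<epsilon> f" by (intro nearI)
    with g(1) show "(\<Union>n. D n) \<inter> near B \<epsilon> f \<noteq> {}" by blast
  qed
  moreover have "|\<Union>n. D n| \<le>o ?r"
    by (rule UNION_Cinfinite_bound[OF card_of_nat_bound[OF Cinfinite_tightness_at] _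
          Cinfinite_tightness_at]) (simp add: D(2))
  moreover have "(\<Union>n. D n) \<subseteq> C" using D(1) by blast
  ultimately show "\<exists>C0\<subseteq>C. |C0| \<le>o ?r \<and> f \<in> coarse_topology closure_of C0" by blast
qed

text \<open>Multiplying \<open>h - f\<close> by \<open>max g 1\<close> turns the tolerance \<open>c / max g 1\<close> into the constant \<open>c\<close>. So coarse
  tightness applies to the deformed sets, one for each \<open>g\<close> of a dominating family, and the union of
  the resulting small sets meets every fine neighbourhood: given \<open>\<epsilon>\<close>, use a \<open>g\<close> with
  \<open>1 / max g 1 \<le> \<epsilon>\<close>.\<close>

lemma tightness_at_fine_upper:
  assumes f: "f \<in> cont_funs"
  shows "tightness_at fine_topology f \<le>o filter_dn *c tightness_at coarse_topology f"
    (is "_ \<le>o ?r")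
proof -
  let ?t = "tightness_at coarse_topology f"
  note r = ordLeq_product[OF Cinfinite_tightness_at[of coarse_topology f]]
  obtain F where F: "filter_dominating F" "|F| \<le>o filter_dn" by (rule filter_dn_witness)
  show ?thesis
  proof (rule tightness_at_ordLeq[OF r(3)])
    fix C assume C: "C \<subseteq> topspace fine_topology" "f \<in> fine_topology closure_of C"
    have C': "C \<subseteq> cont_funs" using C(1) topspace_filter_topology[OF tolerances_pos_cont_funs] by simp
    have max_pos: "0 < max (g x) 1" for g :: "'a \<Rightarrow> real" and x
      by (rule less_le_trans[OF zero_less_one max.cobounded2])
    define \<Theta> where "\<Theta> g h = (\<lambda>x. f x + max (g x) 1 * (h x - f x))" for g h :: "'a \<Rightarrow> real"
    have \<Theta>: "\<bar>f x - \<Theta> g h x\<bar> = max (g x) 1 * \<bar>f x - h x\<bar>" for g h x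
      unfolding \<Theta>_def by (simp add: abs_mult abs_minus_commute)
    have "\<forall>g\<in>F. \<exists>C0. C0 \<subseteq> C \<and> |C0| \<le>o ?t \<and>
      (\<forall>B\<in>\<B>. \<forall>\<epsilon>\<in>const_tolerances. \<exists>h\<in>C0. eventually (\<lambda>x. \<bar>f x - \<Theta> g h x\<bar> < \<epsilon> x) (\<Phi> B))"
    proof
      fix g assume "g \<in> F"
      moreover have "F \<subseteq> cont_funs" using F(1) unfolding filter_dominating_def by (rule conjunct1)
      ultimately have g: "g \<in> cont_funs" by blast
      have "\<Theta> g ` C \<subseteq> cont_funs"
        using f g C' unfolding \<Theta>_def cont_funs_def by (auto intro!: continuous_intros)
      moreover have "\<exists>h\<in>C. eventually (\<lambda>x. \<bar>f x - \<Theta> g h x\<bar> < \<epsilon> x) (\<Phi> B)"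
        if B: "B \<in> \<B>" and \<epsilon>: "\<epsilon> \<in> const_tolerances" for B and \<epsilon> :: "'a \<Rightarrow> real"
      proof -
        obtain c where c: "0 < c" "\<epsilon> = (\<lambda>_. c)" using const_tolerances_D(2)[OF \<epsilon>] by blast
        have "(\<lambda>x. c / max (g x) 1) \<in> pos_cont_funs"
          using g c(1) unfolding pos_cont_funs_def cont_funs_def by (auto intro!: continuous_intros)
        then obtain h where h: "h \<in> C" "eventually (\<lambda>x. \<bar>f x - h x\<bar> < c / max (g x) 1) (\<Phi> B)"
          by (rule closure_of_witness[OF tolerances_pos_cont_funs f C(2) B])
        have "eventually (\<lambda>x. \<bar>f x - \<Theta> g h x\<bar> < \<epsilon> x) (\<Phi> B)"
          using h(2) by (rule eventually_mono) (simp add: \<Theta> c(2) pos_less_divide_eq[OF max_pos] mult.commute)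
        with h(1) show ?thesis by blast
      qed
      ultimately show "\<exists>C0. C0 \<subseteq> C \<and> |C0| \<le>o ?t \<and>
        (\<forall>B\<in>\<B>. \<forall>\<epsilon>\<in>const_tolerances. \<exists>h\<in>C0. eventually (\<lambda>x. \<bar>f x - \<Theta> g h x\<bar> < \<epsilon> x) (\<Phi> B))"
        by (rule pullback_small_subset[OF tolerances_const f])
    qed
    from bchoice[OF this]
    obtain D where "\<forall>g\<in>F. D g \<subseteq> C \<and> |D g| \<le>o ?t \<and>
      (\<forall>B\<in>\<B>. \<forall>\<epsilon>\<in>const_tolerances. \<exists>h\<in>D g. eventually (\<lambda>x. \<bar>f x - \<Theta> g h x\<bar> < \<epsilon> x) (\<Phi> B))"
      by (rule exE)
    note D = this[THEN bspec, THEN conjunct1] this[THEN bspec, THEN conjunct2, THEN conjunct1]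
      this[THEN bspec, THEN conjunct2, THEN conjunct2, THEN bspec, THEN bspec]
    have "f \<in> fine_topology closure_of (\<Union>g\<in>F. D g)"
      unfolding in_closure_of_filter_topology[OF tolerances_pos_cont_funs f]
    proof (intro ballI)
      fix B and \<epsilon> :: "'a \<Rightarrow> real" assume B: "B \<in> \<B>" and \<epsilon>: "\<epsilon> \<in> pos_cont_funs"
      obtain g where g: "g \<in> F" "eventually (\<lambda>x. 1 / max (g x) 1 \<le> \<epsilon> x) (\<Phi> B)"
        by (rule filter_dominating_reciprocal[OF F(1) \<epsilon> B])
      have "(\<lambda>_. 1) \<in> const_tolerances" by (simp add: const_tolerances_I)
      from D(3)[OF g(1) B this]
      obtain h where h: "h \<in> D g" "eventually (\<lambda>x. \<bar>f x - \<Theta> g h x\<bar> < 1) (\<Phi> B)" by (rule bexE)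
      have "eventually (\<lambda>x. \<bar>f x - h x\<bar> < \<epsilon> x) (\<Phi> B)"
        using g(2) h(2)
      proof eventually_elim
        case (elim x)
        have "\<bar>f x - h x\<bar> < 1 / max (g x) 1"
          using elim(2) by (simp add: \<Theta> pos_less_divide_eq[OF max_pos] mult.commute)
        with elim(1) show ?case by simp
      qed
      moreover have "h \<in> cont_funs" using h(1) D(1)[OF g(1)] C' by blast
      ultimately have "h \<in> near B \<epsilon> f" by (intro nearI)
      with h(1) g(1) show "(\<Union>g\<in>F. D g) \<inter> near B \<epsilon> f \<noteq> {}" by blast
    qed
    moreover have "|\<Union>g\<in>F. D g| \<le>o ?r"
    proof (rule UNION_Cinfinite_bound[OF ordLeq_transitive[OF F(2) r(1)] _ r(3)], rule ballI)
      show "|D g| \<le>o ?r" if "g \<in> F" for g by (rule ordLeq_transitive[OF D(2)[OF that] r(2)])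
    qed
    moreover have "(\<Union>g\<in>F. D g) \<subseteq> C" using D(1) by blast
    ultimately show "\<exists>C0\<subseteq>C. |C0| \<le>o ?r \<and> f \<in> fine_topology closure_of C0" by blast
  qed
qed

section \<open>The product formulas\<close>

lemma cont_funs_nonempty: "(cont_funs :: ('a \<Rightarrow> real) set) \<noteq> {}"
proof
  assume empty: "(cont_funs :: ('a \<Rightarrow> real) set) = {}"
  have "(\<lambda>_. 0) \<in> (cont_funs :: ('a \<Rightarrow> real) set)" by (simp add: cont_funs_def)
  then show False unfolding empty by (rule emptyE)
qed

lemma character_fine: "character fine_topology =o filter_dn *c character coarse_topology"
  unfolding character_def topspace_filter_topology[OF tolerances_pos_cont_funs]
    topspace_filter_topology[OF tolerances_const]
proof (rule sup_card_cprod)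
  show "(cont_funs :: ('a \<Rightarrow> real) set) \<noteq> {}" by (rule cont_funs_nonempty)
  show "Cinfinite filter_dn" by (rule Cinfinite_filter_dn)
  fix f :: "'a \<Rightarrow> real" assume f: "f \<in> cont_funs"
  show "Cinfinite (character_at fine_topology f)" "Cinfinite (character_at coarse_topology f)"
    by (rule Cinfinite_character_at)+
  have "filter_dn *c character_at coarse_topology f \<le>o character_at fine_topology f"
    by (rule product_bound[OF Cinfinite_character_at Cinfinite_character_at
          character_at_fine_lower[OF f]])
  with character_at_fine_upper[OF f]
  show "character_at fine_topology f =o filter_dn *c character_at coarse_topology f"
    unfolding ordIso_iff_ordLeq by (rule conjI)
qed

lemma tightness_fine: "tightness fine_topology =o filter_dn *c tightness coarse_topology"
  unfolding tightness_def topspace_filter_topology[OF tolerances_pos_cont_funs]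
    topspace_filter_topology[OF tolerances_const]
proof (rule sup_card_cprod)
  show "(cont_funs :: ('a \<Rightarrow> real) set) \<noteq> {}" by (rule cont_funs_nonempty)
  show "Cinfinite filter_dn" by (rule Cinfinite_filter_dn)
  fix f :: "'a \<Rightarrow> real" assume f: "f \<in> cont_funs"
  show "Cinfinite (tightness_at fine_topology f)" "Cinfinite (tightness_at coarse_topology f)"
    by (rule Cinfinite_tightness_at)+
  have "filter_dn *c tightness_at coarse_topology f \<le>o tightness_at fine_topology f"
    by (rule product_bound[OF Cinfinite_tightness_at Cinfinite_tightness_at
          tightness_at_fine_ge_dn[OF f] tightness_at_coarse_le_fine[OF f]])
  with tightness_at_fine_upper[OF f]
  show "tightness_at fine_topology f =o filter_dn *c tightness_at coarse_topology f"
    unfolding ordIso_iff_ordLeq by (rule conjI)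
qed

end

section \<open>The two filters\<close>

definition enlargement_filter :: "'a::metric_space set \<Rightarrow> 'a filter" where
  "enlargement_filter B = (INF \<delta>\<in>{0<..}. principal (enlargement B \<delta>))"

lemma enlargement_mono: "B \<subseteq> B' \<Longrightarrow> \<delta> \<le> \<delta>' \<Longrightarrow> enlargement B \<delta> \<subseteq> enlargement B' \<delta>'"
  unfolding enlargement_def by fastforce

lemma eventually_enlargement_filter:
  "eventually P (enlargement_filter B) \<longleftrightarrow> (\<exists>\<delta>>0. \<forall>x\<in>enlargement B \<delta>. P x)"
proof -
  have "eventually P (enlargement_filter B) \<longleftrightarrow>
    (\<exists>\<delta>\<in>{0<..}. eventually P (principal (enlargement B \<delta>)))"
    unfolding enlargement_filter_def
  proof (rule eventually_INF_base)
    fix a b :: real assume "a \<in> {0<..}" "b \<in> {0<..}"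
    then show "\<exists>x\<in>{0<..}. principal (enlargement B x) \<le>
        inf (principal (enlargement B a)) (principal (enlargement B b))"
      by (intro bexI[of _ "min a b"])
        (simp_all add: enlargement_mono[OF subset_refl min.cobounded1]
          enlargement_mono[OF subset_refl min.cobounded2])
  qed auto
  then show ?thesis by (auto simp: eventually_principal)
qed

lemma bornology_closed_superset:
  assumes "has_closed_base \<B>" "B \<in> \<B>"
  shows "\<exists>A\<in>\<B>. closed A \<and> B \<subseteq> A"
  using assms unfolding has_closed_base_def bornology_base_def by blast

text \<open>The function grows linearly with the distance from \<open>A\<close>, starting only at half the distance of \<open>x\<close>, so
  that it vanishes on an enlargement of \<open>A\<close> and not merely on \<open>A\<close>.\<close>

lemma separation_from_enlargement:
  fixes A :: "'a::metric_space set"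
  assumes "A \<noteq> {}" "closed A" "x \<notin> A"
  shows "\<exists>h\<in>cont_funs. h x = 1 \<and> (\<exists>\<delta>>0. \<forall>y\<in>enlargement A \<delta>. h y = 0)"
proof -
  define r where "r = infdist x A"
  have r: "0 < r" unfolding r_def using infdist_pos_not_in_closed[OF assms(2,1,3)] .
  let ?h = "\<lambda>y. max 0 (2 * infdist y A / r - 1)"
  have "?h \<in> cont_funs" unfolding cont_funs_def using r by (auto intro!: continuous_intros)
  moreover have "?h x = 1" using r unfolding r_def by simp
  moreover have "\<forall>y\<in>enlargement A (r / 2). ?h y = 0"
  proof
    fix y assume "y \<in> enlargement A (r / 2)"
    then obtain a where a: "a \<in> A" "dist a y < r / 2" unfolding enlargement_def by blast
    then have "infdist y A < r / 2" using infdist_le[OF a(1), of y] by (simp add: dist_commute)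
    then show "?h y = 0" using r by (simp add: field_simps)
  qed
  ultimately show ?thesis using r by (intro bexI[of _ ?h] conjI exI[of _ "r / 2"]) auto
qed

lemma subset_enlargement: "0 < \<delta> \<Longrightarrow> B \<subseteq> enlargement B \<delta>"
  unfolding enlargement_def by force

lemma filtered_bornology_principal:
  assumes "bornology \<B>" "has_closed_base \<B>"
  shows "filtered_bornology \<B> principal"
proof
  fix A :: "'a set" and x assume A: "A \<in> \<B>" "closed A" "x \<notin> A"
  have "A \<noteq> {}" using A(1) assms(1) unfolding bornology_def by blast
  from separation_from_enlargement[OF this A(2,3)]
  show "\<exists>h\<in>cont_funs. h x = 1 \<and> eventually (\<lambda>y. h y = 0) (principal A)"
    unfolding eventually_principal using subset_enlargement by blast
qed (use assms in \<open>auto simp: bornology_nonempty bornology_Un eventually_principal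
    intro: bornology_closed_superset\<close>)

lemma filtered_bornology_enlargement:
  assumes "bornology \<B>" "has_closed_base \<B>"
  shows "filtered_bornology \<B> enlargement_filter"
proof
  fix A :: "'a set" and x assume A: "A \<in> \<B>" "closed A" "x \<notin> A"
  have "A \<noteq> {}" using A(1) assms(1) unfolding bornology_def by blast
  from separation_from_enlargement[OF this A(2,3)]
  show "\<exists>h\<in>cont_funs. h x = 1 \<and> eventually (\<lambda>y. h y = 0) (enlargement_filter A)"
    unfolding eventually_enlargement_filter .
next
  fix B B' :: "'a set" assume "B \<subseteq> B'"
  then show "enlargement_filter B \<le> enlargement_filter B'"
    unfolding le_filter_def eventually_enlargement_filter
    using enlargement_mono[of B B', OF _ order.refl] by blast
next
  fix P B and x :: 'a assume "eventually P (enlargement_filter B)" "x \<in> B"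
  then show "P x" unfolding eventually_enlargement_filter using subset_enlargement by blast
qed (use assms in \<open>auto simp: bornology_nonempty bornology_Un intro: bornology_closed_superset\<close>)

theorem theorem5p1:
  fixes \<B> :: "'a::metric_space set set"
  assumes "\<exists>x y :: 'a. x \<noteq> y"
    and "bornology \<B>"
    and "has_closed_base \<B>"
  shows "(character (tau_sw \<B>) =o dn_s \<B> *c character (tau_s \<B>) \<and>
          character (tau_w \<B>) =o dn \<B> *c character (tau \<B>)) \<and>
         (tightness (tau_sw \<B>) =o dn_s \<B> *c tightness (tau_s \<B>) \<and>
          tightness (tau_w \<B>) =o dn \<B> *c tightness (tau \<B>))"
proof -
  interpret w: filtered_bornology \<B> principal
    by (rule filtered_bornology_principal[OF assms(2,3)])
  interpret s: filtered_bornology \<B> enlargement_filter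
    by (rule filtered_bornology_enlargement[OF assms(2,3)])
  have tau: "tau \<B> = w.filter_topology const_tolerances"
    unfolding tau_def w.filter_topology_def entourages_def w.filter_entourages_const
      eventually_principal ..
  have tau_w: "tau_w \<B> = w.filter_topology pos_cont_funs"
    unfolding tau_w_def w.filter_topology_def entourages_w_def w.filter_entourages_def
      eventually_principal ..
  have tau_s: "tau_s \<B> = s.filter_topology const_tolerances"
    unfolding tau_s_def s.filter_topology_def entourages_s_def s.filter_entourages_const
      eventually_enlargement_filter ..
  have tau_sw: "tau_sw \<B> = s.filter_topology pos_cont_funs"
    unfolding tau_sw_def s.filter_topology_def entourages_sw_def s.filter_entourages_def
      eventually_enlargement_filter ..
  have dn: "dn \<B> = w.filter_dn"
    unfolding dn_def w.filter_dn_def dominating_def w.filter_dominating_def eventually_principal ..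
  have dn_s: "dn_s \<B> = s.filter_dn"
    unfolding dn_s_def s.filter_dn_def strongly_dominating_def s.filter_dominating_def
      eventually_enlargement_filter ..
  show ?thesis
    unfolding tau tau_w tau_s tau_sw dn dn_s
    by (intro conjI w.character_fine w.tightness_fine s.character_fine s.tightness_fine)
qed

end
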